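(* There is an algorithm which, given as input $r\in\mathbb{N}$ and a word $w\in F(x_1,\dots,x_r)$, decides whether $w$ represents the identity in the free metabelian group $M_r$, in time $O(r\,|w|\log_2|w|)$. The algorithm is uniform in $r$, and the constant in the bound does not depend on $r$ or $w$.
   Context: $F=F(x_1,\dots,x_r)$ is the free group of rank $r$, and $M_r=F/F^{(2)}$, where $F'=[F,F]$ and $F^{(2)}=[F',F']$. $|w|$ is the length of the word $w$. Time is the number of elementary steps performed, where moving along one edge of a binary tree and incrementing or decrementing a stored integer count as elementary steps. The bound is understood asymptotically, for $|w|\ge 2$. *)

theory Defs
  imports Complex_Main "HOL-Algebra.Generated_Groups"
begin

section \<open>Free groups and free metabelian groups\<close>

text \<open>The letter \<open>(i, True)\<close> is the generator $x_i$ and \<open>(i, False)\<close> is its inverse.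
  Generators are numbered from 1.\<close>

type_synonym letter = "nat \<times> bool"

definition inv_letter :: "letter \<Rightarrow> letter" where
  "inv_letter a = (fst a, \<not> snd a)"

definition words :: "nat \<Rightarrow> letter list set" where
  "words r = lists ({1..r} \<times> UNIV)"

definition reduced :: "letter list \<Rightarrow> bool" where
  "reduced w \<longleftrightarrow> successively (\<lambda>a b. b \<noteq> inv_letter a) w"

fun push :: "letter \<Rightarrow> letter list \<Rightarrow> letter list" where
  "push a [] = [a]"
| "push a (b # w) = (if b = inv_letter a then w else a # b # w)"

definition reduce :: "letter list \<Rightarrow> letter list" where
  "reduce w = foldr push w []"

definition free_group :: "nat \<Rightarrow> letter list monoid" where
  "free_group r = \<lparr>carrier = {w \<in> words r. reduced w},
                   monoid.mult = (\<lambda>u v. reduce (u @ v)), one = []\<rparr>"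

text \<open>The second derived subgroup $F^{(2)} = [F', F']$.\<close>

definition second_derived :: "nat \<Rightarrow> letter list set" where
  "second_derived r = derived (free_group r) (derived (free_group r) (carrier (free_group r)))"

definition free_metabelian :: "nat \<Rightarrow> letter list set monoid" where
  "free_metabelian r = free_group r Mod second_derived r"

text \<open>The element of $M_r$ represented by a word, which need not be reduced.\<close>

definition represented :: "nat \<Rightarrow> letter list \<Rightarrow> letter list set" where
  "represented r w = second_derived r #>\<^bsub>free_group r\<^esub> reduce w"


subsection \<open>Both are groups\<close>

lemma inv_letter_inv_letter [simp]: "inv_letter (inv_letter a) = a"
  by (simp add: inv_letter_def)

lemma reduced_push: "reduced w \<Longrightarrow> reduced (push a w)"
  by (cases w) (auto simp: reduced_def successively_Cons)

lemma reduced_foldr: "reduced v \<Longrightarrow> reduced (foldr push u v)"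
  by (induction u) (auto simp: reduced_push)

lemma reduced_reduce [simp]: "reduced (reduce w)"
  unfolding reduce_def by (rule reduced_foldr) (simp add: reduced_def)

lemma reduce_reduced: "reduced w \<Longrightarrow> reduce w = w"
proof (induction w)
  case (Cons a w)
  then show ?case
    by (cases w) (auto simp: reduced_def reduce_def)
qed (simp add: reduce_def)

lemma push_inv_push: "reduced w \<Longrightarrow> push (inv_letter a) (push a w) = w"
proof (cases w)
  case (Cons b v)
  assume "reduced w"
  then show ?thesis
    using Cons by (cases v) (auto simp: reduced_def)
qed simp

lemma foldr_push:
  "reduced v \<Longrightarrow> foldr push (push a u) v = push a (foldr push u v)"
proof (cases u)
  case (Cons b u')
  assume "reduced v"
  then have "push a (push (inv_letter a) (foldr push u' v)) = foldr push u' v"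
    using push_inv_push[of _ "inv_letter a"] by (simp add: reduced_foldr)
  then show ?thesis
    using Cons by auto
qed simp

lemma foldr_reduce: "reduced v \<Longrightarrow> foldr push (reduce u) v = foldr push u v"
  unfolding reduce_def by (induction u) (auto simp: foldr_push)

lemma reduce_append_reduce1: "reduce (reduce u @ v) = reduce (u @ v)"
proof -
  have "reduced (foldr push v [])"
    using reduced_reduce[of v] by (simp add: reduce_def)
  then show ?thesis
    by (simp add: foldr_reduce reduce_def[of "_ @ _"])
qed

lemma reduce_append_reduce2: "reduce (u @ reduce v) = reduce (u @ v)"
  using reduce_reduced[OF reduced_reduce[of v]] by (simp add: reduce_def)

lemma words_reduce: "w \<in> words r \<Longrightarrow> reduce w \<in> words r"
proof (induction w)
  case (Cons a w)
  have "push a v \<in> words r" if "v \<in> words r" "a \<in> {1..r} \<times> UNIV" for v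
    using that by (cases v) (auto simp: words_def)
  then show ?case
    using Cons by (auto simp: words_def reduce_def)
qed (simp add: reduce_def)

lemma reduce_left_inverse: "reduce (rev (map inv_letter w) @ w) = []"
proof (induction w)
  case (Cons a w)
  have "foldr push [inv_letter a] (push a (reduce w)) = reduce w"
    by (simp add: push_inv_push)
  then show ?case
    using Cons by (simp add: reduce_def)
qed (simp add: reduce_def)

lemma group_free_group: "group (free_group r)"
proof (rule groupI)
  fix x assume x: "x \<in> carrier (free_group r)"
  then have "rev (map inv_letter x) \<in> words r"
    by (fastforce simp: free_group_def words_def inv_letter_def)
  then have "reduce (rev (map inv_letter x)) \<in> carrier (free_group r)"
    by (simp add: free_group_def words_reduce)
  moreover have "reduce (rev (map inv_letter x)) \<otimes>\<^bsub>free_group r\<^esub> x = \<one>\<^bsub>free_group r\<^esub>"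
    by (simp add: free_group_def reduce_append_reduce1 reduce_left_inverse)
  ultimately show "\<exists>y\<in>carrier (free_group r). y \<otimes>\<^bsub>free_group r\<^esub> x = \<one>\<^bsub>free_group r\<^esub>"
    by blast
next
  fix x y assume "x \<in> carrier (free_group r)" "y \<in> carrier (free_group r)"
  then have "x @ y \<in> words r"
    by (simp add: free_group_def words_def)
  then show "x \<otimes>\<^bsub>free_group r\<^esub> y \<in> carrier (free_group r)"
    by (simp add: free_group_def words_reduce)
qed (simp_all add: free_group_def reduce_append_reduce1 reduce_append_reduce2 reduce_reduced,
     simp add: words_def reduced_def)

lemma group_free_metabelian: "group (free_metabelian r)"
proof -
  interpret group "free_group r" by (rule group_free_group)
  have "second_derived r \<lhd> free_group r"
    unfolding second_derived_def
    by (rule derived_is_normal[OF derived_self_is_normal])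
  then show ?thesis
    unfolding free_metabelian_def by (rule normal.factorgroup_is_group)
qed


section \<open>Machines operating on labelled binary trees\<close>

text \<open>
  A machine has finitely many full infinite binary trees, every vertex of which stores an
  integer, and one head on each tree. (A program mentions only finitely many of the trees
  available in a state.) Apart from the input all stored integers are initially 0,
  so a tree is just a finite tree that grows on demand.

  A vertex is the list of edge directions on the path from it up to the root,
  \<open>True\<close> for right and \<open>False\<close> for left; so the first entry is the edge to the parent,
  and the root is \<open>[]\<close>.
\<close>

record tree =
  label :: "bool list \<Rightarrow> int"
  head :: "bool list"

type_synonym state = "nat \<Rightarrow> tree"

datatype action = Up | Go_Left | Go_Right | Inc | Dec

text \<open>At the root, \<open>Up\<close> has no effect.\<close>

fun act :: "action \<Rightarrow> tree \<Rightarrow> tree" where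
  "act Up T = T\<lparr>head := tl (head T)\<rparr>"
| "act Go_Left T = T\<lparr>head := False # head T\<rparr>"
| "act Go_Right T = T\<lparr>head := True # head T\<rparr>"
| "act Inc T = T\<lparr>label := (label T)(head T := label T (head T) + 1)\<rparr>"
| "act Dec T = T\<lparr>label := (label T)(head T := label T (head T) - 1)\<rparr>"

datatype test = At_Root | Is_Zero | Is_Positive

fun holds :: "test \<Rightarrow> tree \<Rightarrow> bool" where
  "holds At_Root T \<longleftrightarrow> head T = []"
| "holds Is_Zero T \<longleftrightarrow> label T (head T) = 0"
| "holds Is_Positive T \<longleftrightarrow> label T (head T) > 0"

text \<open>The natural number in \<open>Do\<close>, \<open>If\<close> and \<open>While\<close> is the index of the tree that is
  acted on or tested.\<close>

datatype program =
    Skip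
  | Do action nat
  | Seq program program
  | If test nat program program
  | While test nat program

text \<open>\<open>exec P s t s'\<close>: started in \<open>s\<close>, the program halts in state \<open>s'\<close> after exactly \<open>t\<close>
  elementary steps. Each action and each evaluation of a test is one elementary step.\<close>

inductive exec :: "program \<Rightarrow> state \<Rightarrow> nat \<Rightarrow> state \<Rightarrow> bool" where
  Skip: "exec Skip s 1 s"
| Do: "exec (Do a k) s 1 (s(k := act a (s k)))"
| Seq: "exec P s t s' \<Longrightarrow> exec Q s' u s'' \<Longrightarrow> exec (Seq P Q) s (t + u) s''"
| If_True: "holds b (s k) \<Longrightarrow> exec P s t s' \<Longrightarrow> exec (If b k P Q) s (1 + t) s'"
| If_False: "\<not> holds b (s k) \<Longrightarrow> exec Q s t s' \<Longrightarrow> exec (If b k P Q) s (1 + t) s'"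
| While_False: "\<not> holds b (s k) \<Longrightarrow> exec (While b k P) s 1 s"
| While_True: "holds b (s k) \<Longrightarrow> exec P s t s' \<Longrightarrow> exec (While b k P) s' u s'' \<Longrightarrow>
    exec (While b k P) s (1 + t + u) s''"

inductive_cases exec_SkipE: "exec Skip s t s'"
inductive_cases exec_DoE: "exec (Do a k) s t s'"
inductive_cases exec_SeqE: "exec (Seq P Q) s t s'"
inductive_cases exec_IfE: "exec (If b k P Q) s t s'"
inductive_cases exec_WhileE: "exec (While b k P) s t s'"

lemma exec_deterministic:
  "exec P s t s' \<Longrightarrow> exec P s u s'' \<Longrightarrow> u = t \<and> s'' = s'"
proof (induction arbitrary: u s'' rule: exec.induct)
  case (Skip s)
  from Skip.prems show ?case by (rule exec_SkipE) simp
next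
  case (Do a k s)
  from Do.prems show ?case by (rule exec_DoE) simp
next
  case (Seq P s t s' Q v s1)
  from Seq.prems obtain t2 v2 s2 where *: "u = t2 + v2" "exec P s t2 s2" "exec Q s2 v2 s''"
    by (rule exec_SeqE)
  from Seq.IH(1)[OF *(2)] have "t2 = t" "s2 = s'" by simp_all
  with Seq.IH(2) * show ?case by simp
next
  case (If_True b s k P t s' Q)
  from If_True.prems obtain t2 where "u = 1 + t2" "exec P s t2 s''"
    by (rule exec_IfE) (use If_True.hyps in simp_all)
  with If_True.IH show ?case by simp
next
  case (If_False b s k Q t s' P)
  from If_False.prems obtain t2 where "u = 1 + t2" "exec Q s t2 s''"
    by (rule exec_IfE) (use If_False.hyps in simp_all)
  with If_False.IH show ?case by simp
next
  case (While_False b s k P)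
  from While_False.prems show ?case
    by (rule exec_WhileE) (use While_False.hyps in simp_all)
next
  case (While_True b s k P t s' v s1)
  from While_True.prems obtain t2 v2 s2
    where *: "u = 1 + t2 + v2" "exec P s t2 s2" "exec (While b k P) s2 v2 s''"
    by (rule exec_WhileE) (use While_True.hyps in simp_all)
  from While_True.IH(1)[OF *(2)] have "t2 = t" "s2 = s'" by simp_all
  with While_True.IH(2) * show ?case by simp
qed

text \<open>
  Tree 0 holds the input on its rightmost branch: the rank at the root and then the letters
  of the word in order, $x_i$ as $i$ and its inverse as $-i$. Since $i \geq 1$,
  the label 0 marks the end of the word.
\<close>

definition letter_code :: "letter \<Rightarrow> int" where
  "letter_code a = (if snd a then int (fst a) else - int (fst a))"

definition input_label :: "nat \<Rightarrow> letter list \<Rightarrow> bool list \<Rightarrow> int" where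
  "input_label r w v =
     (if v = [] then int r
      else if False \<notin> set v \<and> length v \<le> length w then letter_code (w ! (length v - 1))
      else 0)"

definition input_state :: "nat \<Rightarrow> letter list \<Rightarrow> state" where
  "input_state r w k = \<lparr>label = (if k = 0 then input_label r w else (\<lambda>v. 0)), head = []\<rparr>"

text \<open>The answer is read at the root of tree 1: 1 for yes, 0 for no.\<close>

definition answer :: "state \<Rightarrow> int" where
  "answer s = label (s 1) []"

end

theory Submission
  imports Defs
begin

text \<open>
  A word is trivial in $F/[N,N]$, where $N = F'$, iff its path in the Cayley graph $\mathbb{Z}^r$ of
  $F/N$ crosses every edge equally often in both directions. For words in $N$ the signed number of
  crossings is additive, hence vanishes on $[N,N]$. Conversely, choosing words $t_v$ that lead to
  the vertices $v$ writes the word as a product of the elements $t_u x_i t_{u+e_i}^{-1}$ of $N$, one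
  for each edge crossed, and if these cancel in $N/[N,N]$ then the word lies in $[N,N]$.

  The machine keeps the coordinates of the current vertex modulo $2^L$ in $r$ binary counters
  with $L = O(\log |w|)$ bits. For each letter it walks down a tree along the at most $rL$ bits of all
  counters to the vertex that holds the number of crossings of the current edge and updates it,
  while maintaining the number of edges whose count is nonzero.
\<close>

section \<open>Signed crossings of edges\<close>

text \<open>All counters have the same fixed width: this lets the concatenated bits be cut into
  coordinates again, so that different edges get different vertices of the tree. Working modulo
  \<open>2 ^ L\<close> identifies distant points of the grid, but the path of a word of length n
  stays within distance n of the origin, so injectivity is needed, and proved, only on the edges of
  that path. A stored integer cannot be used as an index or copied in one step, and L is not part of
  the input. Hence each letter is counted down in unary, which costs at most a multiple of r, and L
  is obtained by counting the letters in a numeral of logarithmic length. Walking the whole address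
  afresh for every letter costs O(r L); this is the source of the product in the time bound. On the
  algebraic side one cancellation lemma is used twice: with generators as keys it puts words with
  zero exponent sums into F', with edges as keys it puts balanced words into [F', F'].\<close>

definition sg :: "bool \<Rightarrow> int" where
  "sg c = (if c then 1 else - 1)"

text \<open>The key type is left open because there are three uses: on a word this is the exponent
  sum of a generator, on \<open>edges w v\<close> the net flow through an edge, and on lists of
  addresses the labels that the machine stores in tree 3.\<close>

fun tally :: "('k \<times> bool) list \<Rightarrow> 'k \<Rightarrow> int" where
  "tally [] k = 0"
| "tally (x # xs) k = (if fst x = k then sg (snd x) else 0) + tally xs k"

lemma sg_Not [simp]: "sg (\<not> c) = - sg c"
  by (simp add: sg_def)

lemma tally_append: "tally (xs @ ys) k = tally xs k + tally ys k"
  by (induction xs) auto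

lemma tally_eq_0: "k \<notin> fst ` set xs \<Longrightarrow> tally xs k = 0"
  by (induction xs) auto

lemma finite_tally_support: "finite {k. tally xs k \<noteq> 0}"
  by (rule finite_subset[of _ "fst ` set xs"]) (use tally_eq_0 in force)+

lemma tally_weighted_sum:
  assumes "finite S" "fst ` set xs \<subseteq> S"
  shows "(\<Sum>x\<leftarrow>xs. sg (snd x) * f (fst x)) = (\<Sum>k\<in>S. f k * tally xs k)"
  using assms(2)
proof (induction xs)
  case (Cons x xs)
  have "(\<Sum>k\<in>S. f k * (if fst x = k then sg (snd x) else 0))
      = (\<Sum>k\<in>S. if k = fst x then f (fst x) * sg (snd x) else 0)"
    by (rule sum.cong) auto
  also have "\<dots> = sg (snd x) * f (fst x)"
    using Cons.prems assms(1) by simp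
  finally show ?case
    using Cons by (simp add: distrib_left sum.distrib)
qed simp

lemma tally_map:
  assumes "inj_on f (insert k (fst ` set xs))"
  shows "tally (map (apfst f) xs) (f k) = tally xs k"
  using assms by (induction xs) (auto simp: inj_on_def)

text \<open>Injectivity is asked only on the keys that occur, because addresses coincide for
  vertices that agree modulo \<open>2 ^ L\<close>.\<close>

lemma tally_map_eq_0_iff:
  assumes "inj_on f (fst ` set xs)"
  shows "(\<forall>p. tally (map (apfst f) xs) p = 0) \<longleftrightarrow> (\<forall>k. tally xs k = 0)"
proof -
  have *: "tally (map (apfst f) xs) (f k) = tally xs k" if "k \<in> fst ` set xs" for k
    using that assms by (intro tally_map) (simp add: insert_absorb)
  show ?thesis
  proof (intro iffI allI)
    fix k assume "\<forall>p. tally (map (apfst f) xs) p = 0"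
    with * show "tally xs k = 0"
      by (cases "k \<in> fst ` set xs") (auto intro: tally_eq_0)
  next
    fix p assume "\<forall>k. tally xs k = 0"
    with * show "tally (map (apfst f) xs) p = 0"
      by (cases "p \<in> fst ` set (map (apfst f) xs)") (fastforce, rule tally_eq_0)
  qed
qed

text \<open>The edge from \<open>v\<close> in direction \<open>i\<close> is the pair \<open>(v, i)\<close>, also when it is traversed backwards.\<close>

definition edge :: "(nat \<Rightarrow> int) \<Rightarrow> letter \<Rightarrow> (nat \<Rightarrow> int) \<times> nat" where
  "edge v a = (if snd a then v else v(fst a := v (fst a) - 1), fst a)"

definition move :: "(nat \<Rightarrow> int) \<Rightarrow> letter \<Rightarrow> nat \<Rightarrow> int" where
  "move v a = v(fst a := v (fst a) + sg (snd a))"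

fun edges :: "letter list \<Rightarrow> (nat \<Rightarrow> int) \<Rightarrow> (((nat \<Rightarrow> int) \<times> nat) \<times> bool) list" where
  "edges [] v = []"
| "edges (a # w) v = (edge v a, snd a) # edges w (move v a)"

abbreviation endpoint :: "letter list \<Rightarrow> (nat \<Rightarrow> int) \<Rightarrow> nat \<Rightarrow> int" where
  "endpoint w v \<equiv> foldl move v w"

abbreviation origin :: "nat \<Rightarrow> int" where
  "origin \<equiv> \<lambda>_. 0"

lemma edges_append: "edges (u @ w) v = edges u v @ edges w (endpoint u v)"
  by (induction u arbitrary: v) auto

lemma endpoint_tally: "endpoint w v j = v j + tally w j"
  by (induction w arbitrary: v) (auto simp: move_def)

lemma endpoint_eq_origin: "endpoint w origin = origin \<longleftrightarrow> (\<forall>j. tally w j = 0)"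
  by (auto simp: endpoint_tally fun_eq_iff)

lemma move_inv_letter: "move (move v a) (inv_letter a) = v"
  by (auto simp: move_def inv_letter_def)

lemma edge_inv_letter: "edge (move v a) (inv_letter a) = edge v a"
  by (auto simp: move_def edge_def inv_letter_def sg_def)

lemma tally_push: "tally (push a w) k = tally (a # w) k"
  by (cases w) (auto simp: inv_letter_def)

lemma tally_reduce: "tally (reduce w) k = tally w k"
  unfolding reduce_def by (induction w) (auto simp: tally_push)

lemma endpoint_reduce: "endpoint (reduce w) v = endpoint w v"
  by (rule ext) (simp add: endpoint_tally tally_reduce)

text \<open>A cancelling pair of letters crosses one edge to and fro. Crossing numbers are therefore
  invariants of the element of the free group.\<close>

lemma tally_edges_push: "tally (edges (push a w) v) k = tally (edges (a # w) v) k"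
  by (cases w) (auto simp: move_inv_letter edge_inv_letter, auto simp: inv_letter_def)

lemma tally_edges_reduce: "tally (edges (reduce w) v) k = tally (edges w v) k"
proof (induction w arbitrary: v)
  case (Cons a w)
  have "reduce (a # w) = push a (reduce w)"
    by (simp add: reduce_def)
  with Cons show ?case
    by (simp add: tally_edges_push)
qed (simp add: reduce_def)

section \<open>Products in which every factor cancels\<close>

context group
begin

definition signed :: "('k \<Rightarrow> 'a) \<Rightarrow> 'k \<times> bool \<Rightarrow> 'a" where
  "signed g x = (if snd x then g (fst x) else inv g (fst x))"

fun product :: "('k \<Rightarrow> 'a) \<Rightarrow> ('k \<times> bool) list \<Rightarrow> 'a" where
  "product g [] = \<one>"
| "product g (x # xs) = signed g x \<otimes> product g xs"

lemma product_in_subgroup: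
  assumes "subgroup N G" "\<And>x. x \<in> set xs \<Longrightarrow> g (fst x) \<in> N"
  shows "product g xs \<in> N"
  using assms(2)
  by (induction xs)
     (auto simp: signed_def subgroup.one_closed subgroup.m_closed subgroup.m_inv_closed assms(1))

lemma product_append:
  assumes "\<And>x. x \<in> set (xs @ ys) \<Longrightarrow> g (fst x) \<in> carrier G"
  shows "product g (xs @ ys) = product g xs \<otimes> product g ys"
  using assms
proof (induction xs)
  case Nil
  then show ?case using product_in_subgroup[OF subgroup_self, of ys g] by simp
next
  case (Cons x xs)
  have "signed g x \<in> carrier G" "product g xs \<in> carrier G" "product g ys \<in> carrier G"
    using Cons.prems by (auto simp: signed_def intro!: product_in_subgroup[OF subgroup_self])
  with Cons show ?case by (simp add: m_assoc)
qed

text \<open>Modulo commutators a factor can be moved next to its inverse and cancelled.\<close>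

lemma balanced_product_in_derived:
  assumes N: "subgroup N G"
    and g: "\<And>x. x \<in> set xs \<Longrightarrow> g (fst x) \<in> N"
    and bal: "\<And>k. tally xs k = 0"
  shows "product g xs \<in> derived G N"
  using g bal
proof (induction "length xs" arbitrary: xs rule: less_induct)
  case less
  have sub: "subgroup (derived G N) G"
    using subgroup.subset[OF N] by (rule derived_is_subgroup)
  show ?case
  proof (cases xs)
    case Nil
    then show ?thesis using sub by (simp add: subgroup.one_closed)
  next
    case (Cons x us)
    obtain k c where x: "x = (k, c)" by fastforce
    \<comment> \<open>Otherwise all occurrences of \<open>k\<close> have the sign of
      \<open>c\<close>, and their total could not vanish.\<close>
    have "(k, \<not> c) \<in> set us"
    proof (rule ccontr)
      assume "(k, \<not> c) \<notin> set us"
      then have "0 \<le> sg c * tally us k"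
        by (induction us) (auto simp: sg_def split: if_splits)
      moreover have "tally us k = - sg c"
        using less.prems(2)[of k] by (simp add: Cons x)
      ultimately show False by (simp add: sg_def split: if_splits)
    qed
    then obtain ys zs where us: "us = ys @ (k, \<not> c) # zs"
      by (meson split_list)
    let ?h = "signed g (k, c)" and ?Y = "product g ys" and ?Z = "product g zs"
    have "k \<in> fst ` set xs" using Cons x by force
    then have gk: "g k \<in> N" using less.prems(1) by auto
    have h: "?h \<in> N" using gk N by (auto simp: signed_def subgroup.m_inv_closed)
    have YZ: "?Y \<in> N" "?Z \<in> N"
      using less.prems(1) by (auto intro!: product_in_subgroup[OF N] simp: Cons us)
    have gN: "\<And>x. x \<in> set xs \<Longrightarrow> g (fst x) \<in> carrier G"
      using less.prems(1) subgroup.mem_carrier[OF N] by blast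
    have inv: "signed g (k, \<not> c) = inv ?h"
      using gk subgroup.mem_carrier[OF N] by (auto simp: signed_def)
    have c: "?h \<in> carrier G" "?Y \<in> carrier G" "?Z \<in> carrier G"
      using h YZ subgroup.mem_carrier[OF N] by auto
    have "product g xs = ?h \<otimes> (?Y \<otimes> (inv ?h \<otimes> ?Z))"
      using product_append[of ys "(k, \<not> c) # zs" g] gN by (simp add: Cons x us inv)
    also have "\<dots> = (?h \<otimes> ?Y \<otimes> inv ?h \<otimes> inv ?Y) \<otimes> (?Y \<otimes> ?Z)"
    proof -
      have "inv ?Y \<otimes> (?Y \<otimes> ?Z) = ?Z"
        using c by (simp add: m_assoc[symmetric])
      then show ?thesis
        using c by (simp add: m_assoc)
    qed
    also have "?Y \<otimes> ?Z = product g (ys @ zs)"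
      using gN by (subst product_append) (auto simp: Cons us)
    also have "?h \<otimes> ?Y \<otimes> inv ?h \<otimes> inv ?Y \<in> derived G N"
      unfolding derived_def using h YZ by (intro generate.incl) auto
    moreover have "product g (ys @ zs) \<in> derived G N"
    proof (rule less.hyps)
      show "tally (ys @ zs) l = 0" for l
        using less.prems(2)[of l] by (simp add: Cons x us tally_append split: if_splits)
    qed (use less.prems(1) in \<open>auto simp: Cons us\<close>)
    ultimately show ?thesis
      using subgroup.m_closed[OF sub] by simp
  qed
qed

end

section \<open>Words that are trivial in the free metabelian group\<close>

context
  fixes r :: nat
begin

interpretation F: group "free_group r"
  by (rule group_free_group)

abbreviation (input) F1 :: "letter list set" where
  "F1 \<equiv> derived (free_group r) (carrier (free_group r))"

lemma carrier_free_group: "carrier (free_group r) = {w \<in> words r. reduced w}"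
  by (simp add: free_group_def)

lemma mult_free_group: "u \<otimes>\<^bsub>free_group r\<^esub> v = reduce (u @ v)"
  by (simp add: free_group_def)

lemma one_free_group: "\<one>\<^bsub>free_group r\<^esub> = []"
  by (simp add: free_group_def)

lemma tally_mult: "tally (u \<otimes>\<^bsub>free_group r\<^esub> v) j = tally u j + tally v j"
  by (simp add: mult_free_group tally_reduce tally_append)

lemma tally_inv:
  assumes "u \<in> carrier (free_group r)"
  shows "tally (inv\<^bsub>free_group r\<^esub> u) j = - tally u j"
  using tally_mult[of u "inv\<^bsub>free_group r\<^esub> u" j] assms by (simp add: one_free_group)

lemma subgroup_F1: "subgroup F1 (free_group r)"
  by (rule F.derived_is_subgroup) simp

lemma subgroup_tally_0: "subgroup {u \<in> carrier (free_group r). \<forall>j. tally u j = 0} (free_group r)"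
  by (rule F.subgroupI) (auto simp: tally_mult tally_inv, auto simp: one_free_group
      intro!: exI[of _ "[]"] F.one_closed[unfolded one_free_group])

lemma F1_tally: "u \<in> F1 \<Longrightarrow> tally u j = 0"
proof -
  have "F1 \<subseteq> {u \<in> carrier (free_group r). \<forall>j. tally u j = 0}"
    unfolding derived_def
    by (rule F.generate_subgroup_incl[OF _ subgroup_tally_0]) (auto simp: tally_mult tally_inv)
  then show "u \<in> F1 \<Longrightarrow> tally u j = 0" by blast
qed

lemma F1_carrier: "u \<in> F1 \<Longrightarrow> u \<in> carrier (free_group r)"
  using subgroup_F1 by (rule subgroup.mem_carrier)

text \<open>In general the path of \<open>v\<close> is translated by the endpoint of
  \<open>u\<close>. When \<open>u\<close> is a closed path there is no translation, which is why
  additivity is confined to F'.\<close>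

lemma tally_edges_mult:
  assumes "\<And>j. tally u j = 0"
  shows "tally (edges (u \<otimes>\<^bsub>free_group r\<^esub> v) origin) k
       = tally (edges u origin) k + tally (edges v origin) k"
proof -
  have "endpoint u origin = origin"
    using assms by (simp add: endpoint_eq_origin)
  then show ?thesis
    by (simp add: mult_free_group tally_edges_reduce edges_append tally_append)
qed

lemma tally_edges_inv:
  assumes "u \<in> carrier (free_group r)" "\<And>j. tally u j = 0"
  shows "tally (edges (inv\<^bsub>free_group r\<^esub> u) origin) k = - tally (edges u origin) k"
  using tally_edges_mult[OF assms(2), of "inv\<^bsub>free_group r\<^esub> u" k] assms(1)
  by (simp add: one_free_group)

lemma second_derived_balanced:
  assumes "u \<in> second_derived r"
  shows "tally (edges u origin) k = 0"
proof -
  let ?Z = "{u \<in> carrier (free_group r).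
    (\<forall>j. tally u j = 0) \<and> (\<forall>k. tally (edges u origin) k = 0)}"
  have "subgroup ?Z (free_group r)"
    by (rule F.subgroupI)
       (auto simp: tally_mult tally_inv tally_edges_mult tally_edges_inv, auto simp: one_free_group
        intro!: exI[of _ "[]"] F.one_closed[unfolded one_free_group])
  then have "second_derived r \<subseteq> ?Z"
    unfolding second_derived_def derived_def[of _ F1]
    by (rule F.generate_subgroup_incl[rotated])
       (auto simp: F1_carrier F1_tally tally_mult tally_inv tally_edges_mult tally_edges_inv)
  with assms show ?thesis by blast
qed

lemma generator: "1 \<le> i \<Longrightarrow> i \<le> r \<Longrightarrow> [(i, c)] \<in> carrier (free_group r)"
  by (simp add: carrier_free_group words_def reduced_def)

lemma signed_generator:
  assumes "1 \<le> fst a" "fst a \<le> r"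
  shows "F.signed (\<lambda>i. [(i, True)]) a = [a]"
proof -
  obtain i c where a: "a = (i, c)" by fastforce
  have "inv\<^bsub>free_group r\<^esub> [(i, True)] = [(i, False)]"
    using assms generator
    by (intro F.inv_equality) (auto simp: a mult_free_group one_free_group reduce_def inv_letter_def)
  then show ?thesis
    by (cases c) (auto simp: a F.signed_def)
qed

lemma word_product: "w \<in> words r \<Longrightarrow> F.product (\<lambda>i. [(i, True)]) w = reduce w"
proof (induction w)
  case (Cons a w)
  then have "1 \<le> fst a" "fst a \<le> r" "w \<in> words r"
    by (auto simp: words_def)
  with Cons show ?case
    using reduce_append_reduce2[of "[a]" w]
    by (simp add: signed_generator mult_free_group)
qed (simp add: one_free_group reduce_def)

text \<open>The cancellation lemma with the whole group as subgroup and the generators as keys: zero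
  exponent sums are exactly its balance condition.\<close>

lemma reduce_in_F1:
  assumes "w \<in> words r" "\<And>j. tally w j = 0"
  shows "reduce w \<in> F1"
proof -
  have "F.product (\<lambda>i. [(i, True)]) w \<in> F1"
    using assms by (intro F.balanced_product_in_derived F.subgroup_self)
      (auto simp: words_def generator)
  with assms show ?thesis
    by (simp add: word_product)
qed

section \<open>Schreier transversal and Schreier generators of the commutator subgroup\<close>

definition reachable :: "(nat \<Rightarrow> int) \<Rightarrow> bool" where
  "reachable v \<longleftrightarrow> (\<exists>u \<in> carrier (free_group r). endpoint u origin = v)"

text \<open>The empty word at the origin makes both outer factors of \<open>telescope\<close>
  disappear for closed paths. Unreachable vertices get a dummy value, so that membership in the
  group and telescoping hold without a side condition.\<close>

definition transversal :: "(nat \<Rightarrow> int) \<Rightarrow> letter list" where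
  "transversal v = (if v = origin then []
     else if reachable v
       then SOME u. u \<in> carrier (free_group r) \<and> endpoint u origin = v else [])"

lemma Nil_carrier: "[] \<in> carrier (free_group r)"
  using F.one_closed by (simp add: one_free_group)

lemma transversal:
  "transversal v \<in> carrier (free_group r)"
  "reachable v \<Longrightarrow> endpoint (transversal v) origin = v"
  using someI_ex[of "\<lambda>u. u \<in> carrier (free_group r) \<and> endpoint u origin = v"]
  by (auto simp: transversal_def reachable_def Nil_carrier)

lemma reachable_move:
  assumes "reachable v" "1 \<le> fst a" "fst a \<le> r"
  shows "reachable (move v a)"
proof -
  obtain u where u: "u \<in> carrier (free_group r)" "endpoint u origin = v"
    using assms(1) by (auto simp: reachable_def)
  then have "endpoint (u \<otimes>\<^bsub>free_group r\<^esub> [a]) origin = move v a"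
    by (simp add: mult_free_group endpoint_reduce)
  moreover have "u \<otimes>\<^bsub>free_group r\<^esub> [a] \<in> carrier (free_group r)"
    using u generator[of "fst a" "snd a"] assms by (intro F.m_closed) auto
  ultimately show ?thesis
    by (auto simp: reachable_def)
qed

text \<open>The Schreier generator of an edge: out along the transversal, across the edge, and back
  along the transversal.\<close>

definition loop :: "(nat \<Rightarrow> int) \<times> nat \<Rightarrow> letter list" where
  "loop e = transversal (fst e) \<otimes>\<^bsub>free_group r\<^esub> [(snd e, True)]
     \<otimes>\<^bsub>free_group r\<^esub> inv\<^bsub>free_group r\<^esub> transversal (move (fst e) (snd e, True))"

lemma loop_carrier: "1 \<le> snd e \<Longrightarrow> snd e \<le> r \<Longrightarrow> loop e \<in> carrier (free_group r)"
  by (simp add: loop_def transversal generator)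

lemma loop_in_F1:
  assumes "reachable (fst e)" "1 \<le> snd e" "snd e \<le> r"
  shows "loop e \<in> F1"
proof -
  have "reachable (move (fst e) (snd e, True))"
    using assms by (simp add: reachable_move)
  then have "tally (transversal (move (fst e) (snd e, True))) j = move (fst e) (snd e, True) j"
    "tally (transversal (fst e)) j = fst e j" for j
    using transversal(2)[THEN fun_cong, of _ j] assms by (simp_all add: endpoint_tally)
  then have "tally (loop e) j = 0" for j
    by (simp add: loop_def tally_mult tally_inv transversal) (simp add: move_def)
  moreover have "loop e \<in> carrier (free_group r)"
    using assms by (simp add: loop_carrier)
  ultimately show ?thesis
    using reduce_in_F1[of "loop e"] by (simp add: carrier_free_group reduce_reduced)
qed

text \<open>Inverting a Schreier generator exchanges its two transversal words, so a backward
  crossing has the same shape as a forward one.\<close>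

lemma signed_loop:
  assumes "1 \<le> fst a" "fst a \<le> r"
  shows "F.signed loop (edge v a, snd a) = transversal v \<otimes>\<^bsub>free_group r\<^esub> [a]
     \<otimes>\<^bsub>free_group r\<^esub> inv\<^bsub>free_group r\<^esub> transversal (move v a)"
proof -
  obtain i c where a: "a = (i, c)" by fastforce
  show ?thesis
  proof (cases c)
    case True
    then show ?thesis by (simp add: a F.signed_def loop_def edge_def)
  next
    case False
    let ?t = "transversal v" and ?t' = "transversal (move v a)"
    have "loop (edge v a) = ?t' \<otimes>\<^bsub>free_group r\<^esub> [(i, True)]
        \<otimes>\<^bsub>free_group r\<^esub> inv\<^bsub>free_group r\<^esub> ?t"
      by (simp add: loop_def edge_def move_def sg_def a False)
    moreover have "inv\<^bsub>free_group r\<^esub> [(i, True)] = [a]"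
      using signed_generator[OF assms] by (simp add: F.signed_def a False)
    moreover have "[(i, True)] \<in> carrier (free_group r)" "[a] \<in> carrier (free_group r)"
      using assms generator by (auto simp: a)
    ultimately show ?thesis
      using transversal(1)[of v] transversal(1)[of "move v a"]
      by (simp add: F.signed_def False a F.inv_mult_group F.m_assoc)
  qed
qed

text \<open>Schreier rewriting: consecutive factors meet in the transversal word of a common vertex
  and its inverse, and these cancel.\<close>

lemma telescope:
  "w \<in> words r \<Longrightarrow> F.product loop (edges w v) = transversal v \<otimes>\<^bsub>free_group r\<^esub> reduce w
     \<otimes>\<^bsub>free_group r\<^esub> inv\<^bsub>free_group r\<^esub> transversal (endpoint w v)"
proof (induction w arbitrary: v)
  case Nil
  then show ?case
    using F.r_inv[OF transversal(1)[of v]] F.r_one[OF transversal(1)[of v]]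
    by (simp add: reduce_def one_free_group)
next
  case (Cons a w)
  then have a: "1 \<le> fst a" "fst a \<le> r" and w: "w \<in> words r"
    by (auto simp: words_def)
  have c: "[a] \<in> carrier (free_group r)" "reduce w \<in> carrier (free_group r)"
    using generator[OF a, of "snd a"] w by (simp_all add: carrier_free_group words_reduce)
  have "reduce (a # w) = [a] \<otimes>\<^bsub>free_group r\<^esub> reduce w"
    using reduce_append_reduce2[of "[a]" w] by (simp add: mult_free_group)
  moreover have "inv\<^bsub>free_group r\<^esub> transversal (move v a) \<otimes>\<^bsub>free_group r\<^esub>
      (transversal (move v a) \<otimes>\<^bsub>free_group r\<^esub> z) = z" if "z \<in> carrier (free_group r)" for z
    using that by (simp add: F.m_assoc[symmetric] transversal(1))
  ultimately show ?case
    using Cons.IH[OF w] c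
    by (simp add: signed_loop[OF a] transversal(1) F.m_assoc)
qed

lemma edges_in_F1:
  "w \<in> words r \<Longrightarrow> reachable v \<Longrightarrow> x \<in> set (edges w v) \<Longrightarrow> loop (fst x) \<in> F1"
proof (induction w arbitrary: v)
  case (Cons a w)
  then have a: "1 \<le> fst a" "fst a \<le> r" and w: "w \<in> words r"
    by (auto simp: words_def)
  have "reachable (fst (edge v a))"
    using Cons.prems(2) reachable_move[OF Cons.prems(2) a]
    by (auto simp: edge_def move_def sg_def split: if_splits)
  then have "loop (edge v a) \<in> F1"
    using a by (intro loop_in_F1) (auto simp: edge_def)
  then show ?case
    using Cons.prems(3) Cons.IH[OF w reachable_move[OF Cons.prems(2) a]] by auto
qed simp

lemma tally_from_edges:
  "(\<Sum>x\<leftarrow>edges w v. sg (snd x) * (if snd (fst x) = j then 1 else 0)) = tally w j"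
  by (induction w arbitrary: v) (auto simp: edge_def)

lemma reduce_in_second_derived:
  assumes w: "w \<in> words r" and bal: "\<And>k. tally (edges w origin) k = 0"
  shows "reduce w \<in> second_derived r"
proof -
  \<comment> \<open>The exponent sum of \<open>x_j\<close> is the total of the crossings of all
    edges in direction \<open>j\<close>, so balance alone already forces the path to be
    closed.\<close>
  have "tally w j = 0" for j
    using tally_weighted_sum[of "fst ` set (edges w origin)" "edges w origin"
        "\<lambda>k. if snd k = j then 1 else 0"] bal
    by (simp add: tally_from_edges)
  then have "endpoint w origin = origin"
    by (simp add: endpoint_eq_origin)
  moreover have "transversal origin = \<one>\<^bsub>free_group r\<^esub>"
    by (simp add: transversal_def one_free_group)
  moreover have "reduce w \<in> carrier (free_group r)"
    using w by (simp add: carrier_free_group words_reduce)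
  ultimately have "F.product loop (edges w origin) = reduce w"
    using telescope[OF w, of origin] by simp
  moreover have "reachable origin"
    unfolding reachable_def by (rule bexI[of _ "[]"]) (auto simp: Nil_carrier)
  then have "F.product loop (edges w origin) \<in> derived (free_group r) F1"
    using w bal edges_in_F1 by (intro F.balanced_product_in_derived subgroup_F1)
  ultimately show ?thesis
    by (simp add: second_derived_def)
qed

theorem represented_eq_one_iff:
  assumes w: "w \<in> words r"
  shows "represented r w = \<one>\<^bsub>free_metabelian r\<^esub> \<longleftrightarrow> (\<forall>k. tally (edges w origin) k = 0)"
proof -
  have sub: "subgroup (second_derived r) (free_group r)"
    unfolding second_derived_def using F1_carrier by (intro F.derived_is_subgroup) auto
  have c: "reduce w \<in> carrier (free_group r)"
    using w by (simp add: carrier_free_group words_reduce)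
  have "represented r w = \<one>\<^bsub>free_metabelian r\<^esub> \<longleftrightarrow> reduce w \<in> second_derived r"
    using F.coset_join1[OF _ c sub] F.coset_join2[OF c sub]
    by (auto simp: represented_def free_metabelian_def)
  also have "\<dots> \<longleftrightarrow> (\<forall>k. tally (edges w origin) k = 0)"
    using second_derived_balanced[of "reduce w"] reduce_in_second_derived[OF w]
    by (auto simp: tally_edges_reduce)
  finally show ?thesis .
qed

end

section \<open>Symbolic execution\<close>

notation Seq (infixr ";;" 60)

text \<open>An upper bound instead of the exact time gives branches of different length a common
  cost. The rewrite rules below execute a program symbolically and charge each step to the
  budget.\<close>

definition runs :: "program \<Rightarrow> state \<Rightarrow> state \<Rightarrow> nat \<Rightarrow> bool" where
  "runs P s s' c \<longleftrightarrow> (\<exists>t\<le>c. exec P s t s')"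

lemma runs_mono: "runs P s s' c \<Longrightarrow> c \<le> d \<Longrightarrow> runs P s s' d"
  unfolding runs_def by (meson order_trans)

lemma runs_Seq: "runs P s s' c \<Longrightarrow> runs Q s' s'' d \<Longrightarrow> c + d \<le> e \<Longrightarrow> runs (P ;; Q) s s'' e"
  unfolding runs_def by (meson exec.Seq add_mono order_trans)

lemma exec_Seq_iff: "exec (P ;; Q) s t s'' \<longleftrightarrow> (\<exists>u v s'. t = u + v \<and> exec P s u s' \<and> exec Q s' v s'')"
  by (auto intro: exec.Seq elim!: exec_SeqE)

lemma runs_Seq_iff: "runs (P ;; Q) s s'' c \<longleftrightarrow> (\<exists>u s'. u \<le> c \<and> exec P s u s' \<and> runs Q s' s'' (c - u))"
proof
  assume "runs (P ;; Q) s s'' c"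
  then obtain u v s' where "u + v \<le> c" "exec P s u s'" "exec Q s' v s''"
    by (auto simp: runs_def exec_Seq_iff)
  then show "\<exists>u s'. u \<le> c \<and> exec P s u s' \<and> runs Q s' s'' (c - u)"
    unfolding runs_def by (intro exI[of _ u] exI[of _ s'] conjI exI[of _ v]) auto
next
  assume "\<exists>u s'. u \<le> c \<and> exec P s u s' \<and> runs Q s' s'' (c - u)"
  then obtain u v s' where "u + v \<le> c" "exec P s u s'" "exec Q s' v s''"
    by (auto simp: runs_def le_diff_conv2 add.commute)
  then show "runs (P ;; Q) s s'' c"
    unfolding runs_def by (blast intro: exec.Seq)
qed

text \<open>Brings sequences into right-nested form, so that the rules for a leading statement
  apply.\<close>

lemma runs_Seq_assoc [simp]: "runs ((P ;; Q) ;; R) s s' c \<longleftrightarrow> runs (P ;; Q ;; R) s s' c"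
proof -
  have "exec ((P ;; Q) ;; R) s t s' \<longleftrightarrow> exec (P ;; Q ;; R) s t s'" for t
  proof
    assume "exec ((P ;; Q) ;; R) s t s'"
    then obtain u v w a b where *: "t = u + v + w" "exec P s u a" "exec Q a v b" "exec R b w s'"
      by (auto simp: exec_Seq_iff)
    show "exec (P ;; Q ;; R) s t s'"
      using exec.Seq[OF *(2) exec.Seq[OF *(3,4)]] *(1) by (simp add: add.assoc)
  next
    assume "exec (P ;; Q ;; R) s t s'"
    then obtain u v w a b where *: "t = u + (v + w)" "exec P s u a" "exec Q a v b" "exec R b w s'"
      by (auto simp: exec_Seq_iff)
    show "exec ((P ;; Q) ;; R) s t s'"
      using exec.Seq[OF exec.Seq[OF *(2,3)] *(4)] *(1) by (simp add: add.assoc)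
  qed
  then show ?thesis by (simp add: runs_def)
qed

lemma exec_Do_iff: "exec (Do a k) s t s' \<longleftrightarrow> t = 1 \<and> s' = s(k := act a (s k))"
  using exec.Do[of a k s] by (auto elim: exec_DoE)

lemma exec_Skip_iff: "exec Skip s t s' \<longleftrightarrow> t = 1 \<and> s' = s"
  using exec.Skip[of s] by (auto elim: exec_SkipE)

lemma exec_If_iff: "exec (If b k P Q) s t s' \<longleftrightarrow>
    (\<exists>u. t = Suc u \<and> exec (if holds b (s k) then P else Q) s u s')"
  using exec.If_True[of b s k] exec.If_False[of b s k] by (auto elim!: exec_IfE)

lemma exec_While_True_iff:
  assumes "holds b (s k)"
  shows "exec (While b k P) s t s' \<longleftrightarrow> (\<exists>u. t = Suc u \<and> exec (P ;; While b k P) s u s')"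
proof
  assume "exec (While b k P) s t s'"
  then show "\<exists>u. t = Suc u \<and> exec (P ;; While b k P) s u s'"
    by (rule exec_WhileE) (use assms in \<open>auto intro: exec.Seq\<close>)
next
  assume "\<exists>u. t = Suc u \<and> exec (P ;; While b k P) s u s'"
  then show "exec (While b k P) s t s'"
    using exec.While_True[of b s k, OF assms] by (auto simp: exec_Seq_iff)
qed

lemma exec_While_False_iff:
  assumes "\<not> holds b (s k)"
  shows "exec (While b k P) s t s' \<longleftrightarrow> (\<exists>u. t = Suc u \<and> u = 0 \<and> s' = s)"
  using assms exec.While_False[of b s k P] by (auto elim: exec_WhileE)

lemma runs_Do [simp]: "runs (Do a k) s s' c \<longleftrightarrow> 1 \<le> c \<and> s' = s(k := act a (s k))"
  by (auto simp: runs_def exec_Do_iff)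

lemma runs_Do_Seq [simp]:
  "runs (Do a k ;; Q) s s' c \<longleftrightarrow> 1 \<le> c \<and> runs Q (s(k := act a (s k))) s' (c - 1)"
  by (auto simp: runs_Seq_iff exec_Do_iff)

lemma runs_Skip [simp]: "runs Skip s s' c \<longleftrightarrow> 1 \<le> c \<and> s' = s"
  by (auto simp: runs_def exec_Skip_iff)

lemma runs_Skip_Seq [simp]: "runs (Skip ;; Q) s s' c \<longleftrightarrow> 1 \<le> c \<and> runs Q s s' (c - 1)"
  by (auto simp: runs_Seq_iff exec_Skip_iff)

lemma runs_Suc_iff:
  assumes "\<And>t. exec P s t s' \<longleftrightarrow> (\<exists>u. t = Suc u \<and> exec Q s u s')"
  shows "runs P s s' c \<longleftrightarrow> 1 \<le> c \<and> runs Q s s' (c - 1)"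
  unfolding runs_def assms by (cases c) auto

lemma runs_Seq_Suc_iff:
  assumes "\<And>t s'. exec P s t s' \<longleftrightarrow> (\<exists>u. t = Suc u \<and> exec Q s u s')"
  shows "runs (P ;; R) s s' c \<longleftrightarrow> 1 \<le> c \<and> runs (Q ;; R) s s' (c - 1)"
proof (rule runs_Suc_iff)
  show "exec (P ;; R) s t s' \<longleftrightarrow> (\<exists>u. t = Suc u \<and> exec (Q ;; R) s u s')" for t
  proof
    assume "exec (P ;; R) s t s'"
    then obtain u v x where *: "t = Suc (u + v)" "exec Q s u x" "exec R x v s'"
      by (auto simp: exec_Seq_iff assms)
    then show "\<exists>u. t = Suc u \<and> exec (Q ;; R) s u s'"
      using exec.Seq by blast
  next
    assume "\<exists>u. t = Suc u \<and> exec (Q ;; R) s u s'"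
    then obtain u v x where *: "t = Suc u + v" "exec Q s u x" "exec R x v s'"
      by (auto simp: exec_Seq_iff)
    then have "exec P s (Suc u) x" by (simp add: assms)
    then show "exec (P ;; R) s t s'"
      using * exec.Seq by blast
  qed
qed

lemma runs_If [simp]: "runs (If b k P Q) s s' c \<longleftrightarrow>
    1 \<le> c \<and> runs (if holds b (s k) then P else Q) s s' (c - 1)"
  by (rule runs_Suc_iff) (rule exec_If_iff)

lemma runs_If_Seq [simp]: "runs (If b k P Q ;; R) s s' c \<longleftrightarrow>
    1 \<le> c \<and> runs ((if holds b (s k) then P else Q) ;; R) s s' (c - 1)"
  by (rule runs_Seq_Suc_iff) (rule exec_If_iff)

lemma runs_While_True [simp]:
  assumes "holds b (s k)"
  shows "runs (While b k P ;; R) s s' c \<longleftrightarrow> 1 \<le> c \<and> runs (P ;; While b k P ;; R) s s' (c - 1)"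
  unfolding runs_Seq_assoc[symmetric] by (rule runs_Seq_Suc_iff) (rule exec_While_True_iff[of b s k, OF assms])

lemma runs_While_False [simp]:
  assumes "\<not> holds b (s k)"
  shows "runs (While b k P ;; R) s s' c \<longleftrightarrow> 1 \<le> c \<and> runs R s s' (c - 1)"
  by (cases c) (auto simp: runs_Seq_iff exec_While_False_iff[of b s k P, OF assms])

section \<open>Trees used as integer registers, negated loops, and heads that return to the
  root\<close>

definition cell :: "int \<Rightarrow> tree" where
  "cell x = \<lparr>label = (\<lambda>_. 0)([] := x), head = []\<rparr>"

lemma act_cell [simp]: "act Inc (cell x) = cell (x + 1)" "act Dec (cell x) = cell (x - 1)"
  by (simp_all add: cell_def)

lemma holds_cell [simp]: "holds Is_Zero (cell x) \<longleftrightarrow> x = 0" "holds Is_Positive (cell x) \<longleftrightarrow> x > 0"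
  by (simp_all add: cell_def)

declare act.simps [simp del] holds.simps [simp del]
(* Induction can leave states eta-expanded, and fun_upd_apply would then unfold their updates. *)
declare fun_upd_apply [simp del] fun_upd_same [simp] fun_upd_other [simp]

text \<open>The machine has no loop with a negated test. The root of tree 1 serves as a flag,
  which is 0 outside of \<open>until\<close>, so that loops can be nested.\<close>

definition until :: "test \<Rightarrow> nat \<Rightarrow> program \<Rightarrow> program" where
  "until b k Q = While Is_Zero 1 (If b k (Do Inc 1) Q) ;; Do Dec 1"

lemma runs_until_step:
  assumes "s 1 = cell 0" "\<not> holds b (s k)"
  shows "runs (until b k Q) s s' c \<longleftrightarrow> 2 \<le> c \<and> runs (Q ;; until b k Q) s s' (c - 2)"
  using assms by (auto simp: until_def numeral_2_eq_2 split: if_splits)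

text \<open>The five steps are two successful tests, raising the flag, the failing loop test and
  lowering the flag.\<close>

lemma runs_until_stop:
  assumes "s 1 = cell 0" "holds b (s k)"
  shows "runs (until b k Q) s s' c \<longleftrightarrow> 5 \<le> c \<and> s' = s"
proof -
  have "s(1 := cell 0) = s" using assms(1) by (metis fun_upd_triv)
  then show ?thesis
    using assms by (auto simp: until_def)
qed

text \<open>Tree 0 is the input, 1 the flag and in the end the answer, 2 holds the counters and 3 the
  crossings, 4 a line whose length determines the number of bits, 5 a scratch cell and 6 the number
  of nonzero labels of tree 3.\<close>

definition st :: "tree \<Rightarrow> int \<Rightarrow> tree \<Rightarrow> tree \<Rightarrow> tree \<Rightarrow> int \<Rightarrow> int \<Rightarrow> state" where
  "st T0 f T2 T3 T4 x n = (\<lambda>k. if k = 0 then T0 else if k = 1 then cell f else if k = 2 then T2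
     else if k = 3 then T3 else if k = 4 then T4 else if k = 5 then cell x
     else if k = 6 then cell n else cell 0)"

lemma st_apply [simp]:
  "st T0 f T2 T3 T4 x n 0 = T0" "st T0 f T2 T3 T4 x n (Suc 0) = cell f"
  "st T0 f T2 T3 T4 x n 2 = T2" "st T0 f T2 T3 T4 x n 3 = T3" "st T0 f T2 T3 T4 x n 4 = T4"
  "st T0 f T2 T3 T4 x n 5 = cell x" "st T0 f T2 T3 T4 x n 6 = cell n"
  by (simp_all add: st_def)

lemma st_update [simp]:
  "(st T0 f T2 T3 T4 x n)(0 := T) = st T f T2 T3 T4 x n"
  "(st T0 f T2 T3 T4 x n)(Suc 0 := cell y) = st T0 y T2 T3 T4 x n"
  "(st T0 f T2 T3 T4 x n)(2 := T) = st T0 f T T3 T4 x n"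
  "(st T0 f T2 T3 T4 x n)(3 := T) = st T0 f T2 T T4 x n"
  "(st T0 f T2 T3 T4 x n)(4 := T) = st T0 f T2 T3 T x n"
  "(st T0 f T2 T3 T4 x n)(5 := cell y) = st T0 f T2 T3 T4 y n"
  "(st T0 f T2 T3 T4 x n)(6 := cell y) = st T0 f T2 T3 T4 x y"
  by (rule ext, simp add: st_def fun_upd_apply)+

abbreviation tr :: "(bool list \<Rightarrow> int) \<Rightarrow> bool list \<Rightarrow> tree" where
  "tr l h \<equiv> \<lparr>label = l, head = h\<rparr>"

lemma act_tree [simp]:
  "act Up (tr l h) = tr l (tl h)"
  "act Go_Left (tr l h) = tr l (False # h)" "act Go_Right (tr l h) = tr l (True # h)"
  "act Inc (tr l h) = tr (l(h := l h + 1)) h" "act Dec (tr l h) = tr (l(h := l h - 1)) h"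
  by (simp_all add: act.simps)

lemma holds_tree [simp]:
  "holds At_Root (tr l h) \<longleftrightarrow> h = []"
  "holds Is_Zero (tr l h) \<longleftrightarrow> l h = 0" "holds Is_Positive (tr l h) \<longleftrightarrow> l h > 0"
  by (simp_all add: holds.simps)

definition away :: "bool \<Rightarrow> action" where
  "away c = (if c then Inc else Dec)"

lemma act_away [simp]: "act (away c) (tr l h) = tr (l(h := l h + sg c)) h"
  by (simp add: away_def sg_def)

definition home :: "nat \<Rightarrow> program" where
  "home k = until At_Root k (Do Up k)"

lemma home:
  assumes "s 1 = cell 0" "k \<noteq> 1"
  shows "runs (home k) (s(k := tr l h)) (s(k := tr l [])) (5 + 3 * length h)"
  unfolding home_def
proof (induction h)
  case Nil
  show ?case using assms by (simp add: runs_until_stop)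
next
  case (Cons b h)
  show ?case
    using assms Cons.IH by (simp add: runs_until_step)
qed

section \<open>Counters\<close>

text \<open>A bit is stored as 1 or -1, since the label 0 marks the end of a counter.\<close>

fun put :: "(bool list \<Rightarrow> int) \<Rightarrow> bool list \<Rightarrow> bool list \<Rightarrow> bool list \<Rightarrow> int" where
  "put l h [] = l"
| "put l h (d # ds) = put (l(h := sg d)) (False # h) ds"

text \<open>Unlike \<open>put\<close>, which only writes bits, this includes the end mark 0.\<close>

fun line :: "(bool list \<Rightarrow> int) \<Rightarrow> bool list \<Rightarrow> bool list \<Rightarrow> bool" where
  "line l h [] \<longleftrightarrow> l h = 0"
| "line l h (d # ds) \<longleftrightarrow> l h = sg d \<and> line l (False # h) ds"

lemma sg_simps [simp]: "sg True = 1" "sg False = - 1" "sg c \<noteq> 0" "0 < sg c \<longleftrightarrow> c"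
  by (simp_all add: sg_def)

lemma replicate_Cons_eq: "replicate m a @ a # h = replicate (Suc m) a @ h"
  by (simp add: replicate_app_Cons_same)

lemma put_apply:
  "put l h ds v = (if \<exists>m<length ds. v = replicate m False @ h
     then sg (ds ! (length v - length h)) else l v)"
proof (induction ds arbitrary: l h)
  case (Cons d ds)
  have "(\<exists>m<length (d # ds). v = replicate m False @ h) \<longleftrightarrow>
      v = h \<or> (\<exists>m<length ds. v = replicate m False @ False # h)"
    by (auto simp: replicate_Cons_eq less_Suc_eq_0_disj simp del: replicate.simps)
  moreover have "(d # ds) ! (length v - length h) = ds ! (length v - length (False # h))"
    if "\<exists>m<length ds. v = replicate m False @ False # h"
    using that by auto
  moreover have "v \<noteq> h" if "\<exists>m<length ds. v = replicate m False @ False # h"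
    using that by auto
  ultimately show ?case
    using Cons by (auto simp: fun_upd_apply)
qed simp

lemma line_cong: "(\<And>u. l (u @ h) = l' (u @ h)) \<Longrightarrow> line l h ds = line l' h ds"
proof (induction ds arbitrary: h)
  case Nil
  from Nil[of "[]"] show ?case by simp
next
  case (Cons d ds)
  have "line l (False # h) ds = line l' (False # h) ds"
    using Cons.prems[of "_ @ [False]"] by (intro Cons.IH) simp
  with Cons.prems[of "[]"] show ?case by simp
qed

lemma line_update_above [simp]: "line (l(h := x)) (False # h) ds = line l (False # h) ds"
  by (rule line_cong) (auto simp: fun_upd_apply dest: arg_cong[of _ _ length])

lemma line_nonzero: "line l h ds \<Longrightarrow> m < length ds \<Longrightarrow> l (replicate m False @ h) \<noteq> 0"
proof (induction ds arbitrary: h m)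
  case (Cons d ds)
  show ?case
  proof (cases m)
    case (Suc m')
    then show ?thesis
      using Cons.prems Cons.IH[of "False # h" m'] by (simp add: replicate_app_Cons_same)
  qed (use Cons.prems in simp)
qed simp

lemma put_line: "line l h ds \<Longrightarrow> put l h ds = l"
  by (induction ds arbitrary: l h) (auto simp: fun_upd_idem)

lemma line_end: "line l h ds \<Longrightarrow> l (replicate (length ds) False @ h) = 0"
proof (induction ds arbitrary: h)
  case (Cons d ds)
  then show ?case
    using Cons.IH[of "False # h"] by (simp add: replicate_app_Cons_same)
qed simp

lemma put_put: "length ds \<le> length ds' \<Longrightarrow> put (put l h ds) h ds' = put l h ds'"
proof (rule ext)
  fix v assume len: "length ds \<le> length ds'"
  show "put (put l h ds) h ds' v = put l h ds' v"
  proof (cases "\<exists>m<length ds'. v = replicate m False @ h")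
    case False
    with len have "\<not> (\<exists>m<length ds. v = replicate m False @ h)"
      using less_le_trans by blast
    with False show ?thesis
      by (simp only: put_apply if_False)
  qed (simp only: put_apply if_True)
qed

lemma line_put: "l (replicate (length ds) False @ h) = 0 \<Longrightarrow> line (put l h ds) h ds"
proof (induction ds arbitrary: l h)
  case (Cons d ds)
  have "put (l(h := sg d)) (False # h) ds h = sg d"
    by (auto simp: put_apply dest: arg_cong[of _ _ length])
  moreover have "line (put (l(h := sg d)) (False # h) ds) (False # h) ds"
    using Cons.prems by (intro Cons.IH) (auto simp: replicate_app_Cons_same fun_upd_apply)
  ultimately show ?case by simp
qed simp

text \<open>Least significant bit first. \<open>c = True\<close> adds one and
  \<open>c = False\<close> subtracts one, by the same recursion. The list \<open>e\<close> replaces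
  a carry that runs off the end: \<open>[]\<close> drops it, which is arithmetic modulo a power of
  two, and \<open>[False]\<close> lets the numeral grow.\<close>

fun carry :: "bool \<Rightarrow> bool list \<Rightarrow> bool list \<Rightarrow> bool list" where
  "carry c e [] = e"
| "carry c e (d # ds) = (if d = c then (\<not> c) # carry c e ds else c # ds)"

lemma length_carry [simp]: "length (carry c [] ds) = length ds"
  by (induction ds) auto

text \<open>Bits differ by 2 as labels, hence the doubled actions. \<open>E\<close> runs on the end
  mark: \<open>Skip\<close> discards the overflow, \<open>Do Dec\<close> turns the mark into a new
  digit \<open>False\<close>.\<close>

definition increment :: "nat \<Rightarrow> program \<Rightarrow> program" where
  "increment k E = While Is_Positive k (Do Dec k ;; Do Dec k ;; Do Go_Left k) ;;
     If Is_Zero k E (Do Inc k ;; Do Inc k)"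

text \<open>The head stops where the carry does, so its depth \<open>m\<close> is left existential;
  \<open>climb\<close> or \<open>home\<close> brings it back.\<close>

lemma increment:
  assumes "line l h ds"
    and E: "\<And>l h. l h = 0 \<Longrightarrow> runs E (s(k := tr l h)) (s(k := tr (put l h e) h)) 1"
  shows "\<exists>m\<le>length ds. runs (increment k E) (s(k := tr l h))
    (s(k := tr (put l h (carry True e ds)) (replicate m False @ h))) (4 + 4 * length ds)"
  using assms(1) unfolding increment_def
proof (induction ds arbitrary: l h)
  case Nil
  then show ?case
    using runs_mono[OF E[of l h], of 2] by simp
next
  case (Cons d ds)
  show ?case
  proof (cases d)
    case True
    have "line (l(h := - 1)) (False # h) ds"
      using Cons.prems by simp
    from Cons.IH[OF this] obtain m where m: "m \<le> length ds"
      "runs (While Is_Positive k (Do Dec k ;; Do Dec k ;; Do Go_Left k) ;;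
         If Is_Zero k E (Do Inc k ;; Do Inc k)) (s(k := tr (l(h := - 1)) (False # h)))
         (s(k := tr (put (l(h := - 1)) (False # h) (carry True e ds)) (replicate m False @ False # h)))
         (4 + 4 * length ds)" by blast
    show ?thesis
      using m Cons.prems True by (intro exI[of _ "Suc m"]) (simp add: replicate_app_Cons_same)
  next
    case False
    then show ?thesis
      using Cons.prems by (intro exI[of _ 0]) (simp add: put_line)
  qed
qed

text \<open>No test is true exactly of the label -1. The current label is therefore shifted up by
  one, so that the bit \<open>False\<close> becomes the 0 that the loop detects; the shift is undone
  after the loop.\<close>

definition decrement :: "nat \<Rightarrow> program" where
  "decrement k = Do Inc k ;; While Is_Zero k (Do Inc k ;; Do Go_Left k ;; Do Inc k) ;;
     Do Dec k ;; If Is_Positive k (Do Dec k ;; Do Dec k) Skip"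

lemma decrement:
  assumes "line l h ds"
  shows "\<exists>m\<le>length ds. runs (decrement k) (s(k := tr l h))
    (s(k := tr (put l h (carry False [] ds)) (replicate m False @ h))) (6 + 4 * length ds)"
  using assms unfolding decrement_def
proof (induction ds arbitrary: l h)
  case Nil
  then show ?case
    by (simp add: fun_upd_idem)
next
  case (Cons d ds)
  show ?case
  proof (cases d)
    case False
    have "line (l(h := 1)) (False # h) ds"
      using Cons.prems by simp
    from Cons.IH[OF this] obtain m where m: "m \<le> length ds"
      "runs (Do Inc k ;; While Is_Zero k (Do Inc k ;; Do Go_Left k ;; Do Inc k) ;;
         Do Dec k ;; If Is_Positive k (Do Dec k ;; Do Dec k) Skip) (s(k := tr (l(h := 1)) (False # h)))
         (s(k := tr (put (l(h := 1)) (False # h) (carry False [] ds)) (replicate m False @ False # h)))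
         (6 + 4 * length ds)" by blast
    show ?thesis
      using m Cons.prems False by (intro exI[of _ "Suc m"]) (simp add: replicate_app_Cons_same)
  next
    case True
    then show ?thesis
      using Cons.prems by (intro exI[of _ 0]) (simp add: put_line)
  qed
qed

text \<open>The head may stand on the end mark, whose label is also 0, hence the unconditional first
  \<open>Up\<close>. The next 0 is the vertex from which the line hangs.\<close>

definition climb :: "nat \<Rightarrow> program" where
  "climb k = Do Up k ;; until Is_Zero k (Do Up k)"

lemma climb:
  assumes "s 1 = cell 0" "k \<noteq> 1" "line l (False # h) ds" "l h = 0" "m \<le> length ds"
  shows "runs (climb k) (s(k := tr l (replicate m False @ False # h))) (s(k := tr l h)) (6 + 3 * m)"
  using assms(5) unfolding climb_def
proof (induction m)
  case 0
  show ?case using assms(1,2,4) by (simp add: runs_until_stop)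
next
  case (Suc m)
  have "l (replicate m False @ False # h) \<noteq> 0"
    using Suc.prems assms(3) by (simp add: line_nonzero)
  then show ?case
    using assms(1,2) Suc.prems Suc.IH by (simp add: runs_until_step)
qed

definition step :: "bool \<Rightarrow> program" where
  "step c = Do Go_Left 2 ;; (if c then increment 2 Skip else decrement 2) ;; climb 2"

lemma step:
  assumes "s 1 = cell 0" "line l (False # h) ds" "l h = 0"
  shows "runs (step c) (s(2 := tr l h)) (s(2 := tr (put l (False # h) (carry c [] ds)) h)) (13 + 7 * length ds)"
proof -
  let ?l = "put l (False # h) (carry c [] ds)"
  obtain m where m: "m \<le> length ds"
    "runs (if c then increment 2 Skip else decrement 2) (s(2 := tr l (False # h)))
      (s(2 := tr ?l (replicate m False @ False # h))) (6 + 4 * length ds)"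
  proof (cases c)
    case True
    then show ?thesis
      using increment[of l "False # h" ds Skip s 2 "[]"] assms(2) that
      using runs_mono[of "increment 2 Skip" _ _ "4 + 4 * length ds" "6 + 4 * length ds"] by auto
  next
    case False
    then show ?thesis
      using decrement[of l "False # h" ds 2 s] assms(2) that by auto
  qed
  have "l (replicate (length ds) False @ False # h) = 0"
    using assms(2) by (rule line_end)
  then have "line ?l (False # h) (carry c [] ds)"
    by (intro line_put) simp
  moreover have "?l h = 0"
    using assms(3) by (auto simp: put_apply dest: arg_cong[of _ _ length])
  ultimately have "runs (climb 2) (s(2 := tr ?l (replicate m False @ False # h))) (s(2 := tr ?l h))
      (6 + 3 * m)"
    using m(1) assms(1) by (intro climb[where ds = "carry c [] ds"]) auto
  then have "runs ((if c then increment 2 Skip else decrement 2) ;; climb 2)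
      (s(2 := tr l (False # h))) (s(2 := tr ?l h)) (12 + 7 * length ds)"
    using m(1) by (intro runs_Seq[OF m(2)]) auto
  then show ?thesis
    by (simp add: step_def)
qed

section \<open>Two's complement representation of integers modulo powers of two\<close>

fun bits :: "nat \<Rightarrow> int \<Rightarrow> bool list" where
  "bits 0 x = []"
| "bits (Suc n) x = odd x # bits n (x div 2)"

lemma length_bits [simp]: "length (bits n x) = n"
  by (induction n arbitrary: x) auto

lemma bits_0: "bits n 0 = replicate n False"
  by (induction n) auto

text \<open>Dropping the last carry matches truncation to \<open>n\<close> bits, so no bound on
  \<open>x\<close> is involved.\<close>

lemma carry_bits: "carry c [] (bits n x) = bits n (x + sg c)"
proof (induction n arbitrary: x)
  case (Suc n)
  have "(x + sg c) div 2 = (if odd x = c then x div 2 + sg c else x div 2)"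
    by (cases c; cases "even x") (auto elim!: evenE oddE)
  moreover have "odd (x + sg c) \<longleftrightarrow> even x"
    by (simp add: sg_def)
  ultimately show ?case
    using Suc by auto
qed simp

lemma bits_eq_dvd: "bits n x = bits n y \<Longrightarrow> 2 ^ n dvd x - y"
proof (induction n arbitrary: x y)
  case (Suc n)
  then have d: "2 ^ n dvd x div 2 - y div 2" and "even x \<longleftrightarrow> even y"
    by simp_all
  then have "2 * (x div 2 - y div 2) = x - y"
    by (cases "even x") (auto elim!: evenE oddE)
  moreover have "2 * 2 ^ n dvd 2 * (x div 2 - y div 2)"
    using d by (rule mult_dvd_mono[OF dvd_refl])
  ultimately show ?case
    by (simp only: power_Suc)
qed simp

lemma bits_inj:
  assumes "bits n x = bits n y" "\<bar>x - y\<bar> < 2 ^ n"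
  shows "x = y"
  using zdvd_imp_le[of "2 ^ n" "\<bar>x - y\<bar>"] bits_eq_dvd[OF assms(1)] assms(2) by fastforce

section \<open>A comb of counters in one tree\<close>

fun puts :: "(bool list \<Rightarrow> int) \<Rightarrow> bool list \<Rightarrow> bool list list \<Rightarrow> bool list \<Rightarrow> int" where
  "puts l h [] = l"
| "puts l h (d # dss) = puts (put l (False # h) d) (True # h) dss"

text \<open>The spine runs to the right and every counter hangs to the left of a spine vertex. Spine
  labels are 0 so that \<open>climb\<close> stops there. Since counters are nonempty, a 0 at the
  left child of a spine vertex marks the end of the comb.\<close>

fun counters :: "(bool list \<Rightarrow> int) \<Rightarrow> bool list \<Rightarrow> bool list list \<Rightarrow> bool" where
  "counters l h [] \<longleftrightarrow> l (False # h) = 0"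
| "counters l h (d # dss) \<longleftrightarrow>
     l h = 0 \<and> d \<noteq> [] \<and> line l (False # h) d \<and> counters l (True # h) dss"

text \<open>Vertices list their edges upwards, so the common \<open>h\<close> is a suffix to be
  cancelled; then on the left only the side of the left-going line lacks a right edge.\<close>

lemma branches_disjoint:
  "replicate m False @ False # h \<noteq> replicate n False @ False # replicate i True @ True # h"
proof
  assume "replicate m False @ False # h = replicate n False @ False # replicate i True @ True # h"
  then have "(replicate m False @ [False]) @ h = (replicate n False @ False # replicate i True @ [True]) @ h"
    by simp
  then have "replicate m False @ [False] = replicate n False @ False # replicate i True @ [True]"
    by (simp only: append_same_eq)
  then have "True \<in> set (replicate m False @ [False])"
    by simp
  then show False by simp
qed

lemma put_commute:
  "put (put l (False # replicate i True @ True # h) d) (False # h) d' =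
   put (put l (False # h) d') (False # replicate i True @ True # h) d"
  by (rule ext) (auto simp: put_apply branches_disjoint branches_disjoint[symmetric])

lemma put_puts:
  "put (puts l (replicate i True @ True # h) dss) (False # h) d =
   puts (put l (False # h) d) (replicate i True @ True # h) dss"
proof (induction dss arbitrary: i l)
  case (Cons a dss)
  show ?case
    using Cons.IH[of "put l (False # replicate i True @ True # h) a" "Suc i"]
    by (simp add: put_commute)
qed simp

lemma put_puts_nth:
  "j < length dss \<Longrightarrow> length d = length (dss ! j) \<Longrightarrow>
   put (puts l h dss) (False # replicate j True @ h) d = puts l h (dss[j := d])"
proof (induction dss arbitrary: j l h)
  case (Cons a dss)
  show ?case
  proof (cases j)
    case 0
    then show ?thesis
      using Cons.prems put_puts[of "put l (False # h) a" 0 h dss d] by (simp add: put_put)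
  next
    case (Suc j')
    then show ?thesis
      using Cons.prems Cons.IH[of j' "put l (False # h) a" "True # h"]
      by (simp add: replicate_app_Cons_same)
  qed
qed simp

lemma puts_outside: "(\<And>u. v \<noteq> u @ h) \<Longrightarrow> puts l h dss v = l v"
proof (induction dss arbitrary: l h)
  case (Cons d dss)
  have "v \<noteq> u @ True # h" "v \<noteq> u @ False # h" for u
    using Cons.prems[of "u @ [True]"] Cons.prems[of "u @ [False]"] by auto
  moreover from this have "put l (False # h) d v = l v"
    by (auto simp: put_apply)
  ultimately show ?case
    using Cons.IH[of "True # h" "put l (False # h) d"] by simp
qed simp

lemma counters_cong:
  "(\<And>u. l (u @ h) = l' (u @ h)) \<Longrightarrow> counters l h dss = counters l' h dss"
proof (induction dss arbitrary: h)
  case Nil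
  from Nil[of "[False]"] show ?case by simp
next
  case (Cons d dss)
  have "line l (False # h) d = line l' (False # h) d"
    using Cons.prems[of "_ @ [False]"] by (intro line_cong) simp
  moreover have "counters l (True # h) dss = counters l' (True # h) dss"
    using Cons.prems[of "_ @ [True]"] by (intro Cons.IH) simp
  ultimately show ?case
    using Cons.prems[of "[]"] by simp
qed

lemma counters_puts:
  "(\<And>u. l (u @ h) = 0) \<Longrightarrow> [] \<notin> set dss \<Longrightarrow> counters (puts l h dss) h dss"
proof (induction dss arbitrary: h)
  case Nil
  from Nil(1)[of "[False]"] show ?case by simp
next
  case (Cons d dss)
  let ?l = "puts l (True # h) dss"
  \<comment> \<open>Teeth are disjoint, so the first one can be written last; then
    \<open>line_put\<close> applies to the final labelling.\<close>
  have eq: "puts l h (d # dss) = put ?l (False # h) d"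
    using put_puts[of l 0 h dss d] by simp
  have "counters ?l (True # h) dss"
    using Cons.prems(1)[of "_ @ [True]"] Cons.prems(2) by (intro Cons.IH) auto
  moreover have ne: "replicate m False @ False # h \<noteq> u @ True # h" for m u
  proof
    assume "replicate m False @ False # h = u @ True # h"
    then have "(replicate m False @ [False]) @ h = (u @ [True]) @ h" by simp
    then have "replicate m False @ [False] = u @ [True]" by (simp only: append_same_eq)
    then show False by simp
  qed
  then have "put ?l (False # h) d (u @ True # h) = ?l (u @ True # h)" for u
    by (auto simp: put_apply dest: sym)
  ultimately have "counters (put ?l (False # h) d) (True # h) dss"
    using counters_cong[of "put ?l (False # h) d" "True # h" ?l dss] by blast
  moreover have "?l (replicate (length d) False @ False # h) = 0"
    using ne Cons.prems(1)[of "replicate (length d) False @ [False]"]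
    by (subst puts_outside) auto
  then have "line (put ?l (False # h) d) (False # h) d"
    by (rule line_put)
  moreover have "put ?l (False # h) d h = 0"
  proof -
    have "?l h = l h"
      by (rule puts_outside) (auto dest: arg_cong[of _ _ length])
    then show ?thesis
      using Cons.prems(1)[of "[]"] by (auto simp: put_apply dest: arg_cong[of _ _ length])
  qed
  moreover have "d \<noteq> []"
    using Cons.prems(2) by auto
  ultimately show ?case
    by (simp only: eq counters.simps) simp
qed

lemma counters_nth:
  "counters l h dss \<Longrightarrow> j < length dss \<Longrightarrow>
   l (replicate j True @ h) = 0 \<and> line l (False # replicate j True @ h) (dss ! j)"
proof (induction dss arbitrary: h j)
  case (Cons d dss)
  then show ?case
    using Cons.IH[of "True # h"] by (cases j) (auto simp: replicate_app_Cons_same)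
qed simp

section \<open>Processing a letter\<close>

definition vec :: "nat \<Rightarrow> nat \<Rightarrow> (nat \<Rightarrow> int) \<Rightarrow> bool list list" where
  "vec r L v = map (\<lambda>j. bits L (v j)) [1..<Suc r]"

text \<open>Starting the comb at \<open>[True]\<close> puts the counter of \<open>x_i\<close> at the
  spine vertex that is reached from the root by \<open>i\<close> moves to the right.\<close>

definition ctr :: "nat \<Rightarrow> nat \<Rightarrow> (nat \<Rightarrow> int) \<Rightarrow> bool list \<Rightarrow> int" where
  "ctr r L v = puts (\<lambda>_. 0) [True] (vec r L v)"

lemma length_vec [simp]: "length (vec r L v) = r"
  by (simp add: vec_def)

lemma vec_nth: "j < r \<Longrightarrow> vec r L v ! j = bits L (v (Suc j))"
  by (simp add: vec_def del: upt_Suc)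

lemma vec_update: "j < r \<Longrightarrow> (vec r L v)[j := bits L x] = vec r L (v(Suc j := x))"
  by (rule nth_equalityI) (auto simp: vec_nth nth_list_update fun_upd_apply)

lemma counters_ctr: "0 < L \<Longrightarrow> counters (ctr r L v) [True] (vec r L v)"
  unfolding ctr_def by (rule counters_puts) (auto simp: vec_def dest: arg_cong[of _ _ length])

lemma step_counter:
  assumes "s 1 = cell 0" "0 < L" "1 \<le> i" "i \<le> r"
  shows "runs (step c) (s(2 := tr (ctr r L v) (replicate i True)))
    (s(2 := tr (ctr r L (v(i := v i + sg c))) (replicate i True))) (13 + 7 * L)"
proof -
  obtain j where i: "i = Suc j" and j: "j < r"
    using assms(3,4) by (cases i) auto
  have h: "replicate i True = replicate j True @ [True]"
    by (simp add: i replicate_append_same)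
  have "put (ctr r L v) (False # replicate j True @ [True]) (carry c [] (vec r L v ! j))
      = ctr r L (v(i := v i + sg c))"
    unfolding ctr_def using j
    by (subst put_puts_nth) (simp_all add: vec_nth carry_bits vec_update i)
  then show ?thesis
    using step[of s "ctr r L v" "replicate j True @ [True]" "vec r L v ! j" c]
      counters_nth[OF counters_ctr[OF assms(2)], of j r v] assms(1) j
    by (simp add: h vec_nth)
qed

definition read :: program where
  "read = until Is_Zero 2 (If Is_Positive 2 (Do Go_Right 3) (Do Go_Left 3) ;; Do Go_Left 2)"

lemma read:
  "line l h ds \<Longrightarrow> runs read (st T0 0 (tr l h) (tr l3 p) T4 x n)
     (st T0 0 (tr l (replicate (length ds) False @ h)) (tr l3 (rev ds @ p)) T4 x n)
     (5 + 5 * length ds)"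
  unfolding read_def
proof (induction ds arbitrary: h p)
  case Nil
  then show ?case by (simp add: runs_until_stop)
next
  case (Cons d ds)
  then show ?case
    using Cons.IH[of "False # h" "d # p"]
    by (cases d) (simp_all add: runs_until_step replicate_app_Cons_same)
qed

definition lookup_loop :: program where
  "lookup_loop = until Is_Zero 2 (read ;; climb 2 ;; Do Go_Right 2 ;; Do Go_Left 2)"

lemma lookup_loop:
  "counters l h dss \<Longrightarrow> (\<And>d. d \<in> set dss \<Longrightarrow> length d = L) \<Longrightarrow>
   runs lookup_loop (st T0 0 (tr l (False # h)) (tr l3 p) T4 x n)
     (st T0 0 (tr l (False # replicate (length dss) True @ h)) (tr l3 (rev (concat dss) @ p)) T4 x n)
     (5 + length dss * (15 + 8 * L))"
proof (induction dss arbitrary: h p)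
  case Nil
  then show ?case by (simp add: lookup_loop_def runs_until_stop)
next
  case (Cons d dss)
  let ?s = "\<lambda>h2 p. st T0 0 (tr l h2) (tr l3 p) T4 x n"
  have line: "line l (False # h) d" and l: "l h = 0" and d: "d \<noteq> []" "length d = L"
    using Cons.prems by auto
  then have "l (False # h) \<noteq> 0"
    by (cases d) auto
  have 1: "runs (climb 2 ;; Do Go_Right 2 ;; Do Go_Left 2)
      (?s (replicate (length d) False @ False # h) (rev d @ p)) (?s (False # True # h) (rev d @ p))
      (8 + 3 * L)"
  proof (rule runs_Seq)
    show "runs (climb 2) (?s (replicate (length d) False @ False # h) (rev d @ p))
        (?s h (rev d @ p)) (6 + 3 * L)"
      using climb[of "?s h (rev d @ p)" 2 l h d "length d"] line l d by simp
    show "runs (Do Go_Right 2 ;; Do Go_Left 2) (?s h (rev d @ p)) (?s (False # True # h) (rev d @ p)) 2"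
      by simp
  qed simp
  have 2: "runs lookup_loop (?s (False # True # h) (rev d @ p))
      (?s (False # replicate (length (d # dss)) True @ h) (rev (concat (d # dss)) @ p))
      (5 + length dss * (15 + 8 * L))"
    using Cons.IH[of "True # h" "rev d @ p"] Cons.prems by (simp add: replicate_app_Cons_same)
  have "runs ((read ;; climb 2 ;; Do Go_Right 2 ;; Do Go_Left 2) ;; lookup_loop) (?s (False # h) p)
      (?s (False # replicate (length (d # dss)) True @ h) (rev (concat (d # dss)) @ p))
      (18 + 8 * L + length dss * (15 + 8 * L))"
    using d by (intro runs_Seq[OF runs_Seq[OF read[OF line] 1 order_refl] 2]) auto
  then show ?case
    using \<open>l (False # h) \<noteq> 0\<close> unfolding lookup_loop_def
    by (subst runs_until_step) (simp_all add: add.assoc del: runs_Seq_assoc)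
qed

definition lookup :: program where
  "lookup = Do Go_Right 2 ;; Do Go_Left 2 ;; lookup_loop ;; home 2"

lemma lookup:
  assumes "0 < L"
  shows "runs lookup (st T0 0 (tr (ctr r L v) []) (tr l3 []) T4 x n)
    (st T0 0 (tr (ctr r L v) []) (tr l3 (rev (concat (vec r L v)))) T4 x n)
    (18 + r * (18 + 8 * L))"
proof -
  let ?s = "\<lambda>h2. st T0 0 (tr (ctr r L v) h2) (tr l3 (rev (concat (vec r L v)))) T4 x n"
  let ?h = "False # replicate r True @ [True]"
  have 1: "runs lookup_loop (st T0 0 (tr (ctr r L v) [False, True]) (tr l3 []) T4 x n) (?s ?h)
      (5 + r * (15 + 8 * L))"
    using lookup_loop[OF counters_ctr[OF assms, of r v], of L T0 l3 "[]" T4 x n]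
    by (simp add: vec_def del: upt_Suc) force
  have 2: "runs (home 2) (?s ?h) (?s []) (11 + 3 * r)"
    using home[of "?s []" 2 "ctr r L v" ?h] by simp
  have "5 + r * (15 + 8 * L) + (11 + 3 * r) \<le> 16 + r * (18 + 8 * L)"
    by (simp add: algebra_simps)
  with runs_Seq[OF 1 2] have "runs (lookup_loop ;; home 2)
     (st T0 0 (tr (ctr r L v) [False, True]) (tr l3 []) T4 x n) (?s []) (16 + r * (18 + 8 * L))"
    by blast
  then show ?thesis
    by (simp add: lookup_def)
qed

section \<open>The number of nonzero crossing counts and its update\<close>

definition support :: "('k \<times> bool) list \<Rightarrow> int" where
  "support xs = int (card {k. tally xs k \<noteq> 0})"

lemma support_eq_0_iff: "support xs = 0 \<longleftrightarrow> (\<forall>k. tally xs k = 0)"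
  using finite_tally_support[of xs] by (auto simp: support_def)

lemma tally_snoc: "tally (xs @ [(p, c)]) = (tally xs)(p := tally xs p + sg c)"
  by (rule ext) (auto simp: tally_append fun_upd_apply)

lemma support_snoc:
  "support (xs @ [(p, c)]) = support xs + (if tally xs p = 0 then 1 else 0)
     - (if tally xs p + sg c = 0 then 1 else 0)"
proof -
  let ?A = "{k. tally xs k \<noteq> 0}" and ?B = "{k. tally (xs @ [(p, c)]) k \<noteq> 0}"
  have fin: "finite ?A" by (rule finite_tally_support)
  consider "tally xs p = 0" | "tally xs p \<noteq> 0" "tally xs p + sg c = 0"
    | "tally xs p \<noteq> 0" "tally xs p + sg c \<noteq> 0" by blast
  then show ?thesis
  proof cases
    case 1
    then have "?B = insert p ?A" by (auto simp: tally_snoc fun_upd_apply)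
    with 1 fin show ?thesis by (simp add: support_def)
  next
    case 2
    then have "?B = ?A - {p}" by (auto simp: tally_snoc fun_upd_apply)
    moreover have "0 < card ?A" using 2 fin by (auto simp: card_gt_0_iff)
    ultimately show ?thesis using 2 fin by (simp add: support_def card_Diff_singleton)
  next
    case 3
    then have "?B = ?A" by (auto simp: tally_snoc fun_upd_apply)
    with 3 show ?thesis by (simp add: support_def)
  qed
qed

text \<open>The tests before and after the update realise the two correction terms of
  \<open>support_snoc\<close>.\<close>

definition bump :: "bool \<Rightarrow> program" where
  "bump c = If Is_Zero 3 (Do Inc 6) Skip ;; Do (away c) 3 ;; If Is_Zero 3 (Do Dec 6) Skip"

lemma bump:
  "runs (bump c) (st T0 f T2 (tr (tally xs) p) T4 x (support xs))
     (st T0 f T2 (tr (tally (xs @ [(p, c)])) p) T4 x (support (xs @ [(p, c)]))) 5"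
  by (cases "tally xs p = 0"; cases "tally xs p + sg c = 0")
     (simp_all add: bump_def tally_snoc support_snoc)

text \<open>The letter is driven to 0 with one move along the spine per unit, which selects its
  counter. Cell 5 remembers the amount for \<open>restore\<close>.\<close>

definition locate :: "bool \<Rightarrow> program" where
  "locate c = until Is_Zero 0 (Do (away (\<not> c)) 0 ;; Do Inc 5 ;; Do Go_Right 2)"

lemma locate:
  "l0 h0 = sg c * int i \<Longrightarrow> runs (locate c) (st (tr l0 h0) 0 (tr l2 h) T3 T4 x n)
     (st (tr (l0(h0 := 0)) h0) 0 (tr l2 (replicate i True @ h)) T3 T4 (x + int i) n) (5 + 5 * i)"
  unfolding locate_def
proof (induction i arbitrary: l0 h x)
  case 0
  then show ?case by (simp add: runs_until_stop fun_upd_idem)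
next
  case (Suc i)
  then have "l0 h0 \<noteq> 0" by simp
  moreover have "l0 h0 - sg c = sg c * int i"
    using Suc.prems by (simp add: algebra_simps)
  ultimately show ?case
    using Suc.IH[of "l0(h0 := l0 h0 - sg c)" "True # h" "x + 1"]
    by (simp add: runs_until_step replicate_app_Cons_same add.assoc)
qed

text \<open>Besides repairing the letter, this leads the head of tree 2 to the same counter again
  for the second half of the move.\<close>

definition restore :: "bool \<Rightarrow> program" where
  "restore c = until Is_Zero 5 (Do Dec 5 ;; Do (away c) 0 ;; Do Go_Right 2)"

lemma restore:
  "runs (restore c) (st (tr l0 h0) 0 (tr l2 h) T3 T4 (int i) n)
     (st (tr (l0(h0 := l0 h0 + sg c * int i)) h0) 0 (tr l2 (replicate i True @ h)) T3 T4 0 n)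
     (5 + 5 * i)"
  unfolding restore_def
proof (induction i arbitrary: l0 h)
  case 0
  show ?case by (simp add: runs_until_stop)
next
  case (Suc i)
  show ?case
    using Suc.IH[of "l0(h0 := l0 h0 + sg c)" "True # h"]
    by (simp add: runs_until_step replicate_app_Cons_same algebra_simps)
qed

text \<open>The counters hold doubled coordinates, so that the edge from \<open>u\<close> in direction \<open>i\<close> has
  the integral midpoint \<open>2u + e\<^sub>i\<close>, which the machine passes halfway through the letter.\<close>

definition process :: "bool \<Rightarrow> program" where
  "process c = locate c ;; step c ;; home 2 ;; lookup ;; bump c ;; home 3 ;;
     restore c ;; step c ;; home 2"

lemma process:
  fixes v :: "nat \<Rightarrow> int" and xs :: "(bool list \<times> bool) list"
  assumes "l0 h0 = sg c * int i" "0 < L" "1 \<le> i" "i \<le> r"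
  defines "v1 \<equiv> v(i := v i + sg c)" and "v2 \<equiv> v(i := v i + 2 * sg c)"
  defines "xs' \<equiv> xs @ [(rev (concat (vec r L v1)), c)]"
  shows "runs (process c)
    (st (tr l0 h0) 0 (tr (ctr r L v) []) (tr (tally xs) []) T4 0 (support xs))
    (st (tr l0 h0) 0 (tr (ctr r L v2) []) (tr (tally xs') []) T4 0 (support xs'))
    (140 * (r * L))"
proof -
  let ?T = "tr (l0(h0 := 0)) h0" and ?h = "replicate i True" and ?p = "rev (concat (vec r L v1))"
  have v2: "v1(i := v1 i + sg c) = v2"
    by (simp add: v1_def v2_def algebra_simps)
  have 1: "runs (locate c)
      (st (tr l0 h0) 0 (tr (ctr r L v) []) (tr (tally xs) []) T4 0 (support xs))
      (st ?T 0 (tr (ctr r L v) ?h) (tr (tally xs) []) T4 (int i) (support xs)) (5 + 5 * i)"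
    using locate[of l0 h0 c i "ctr r L v" "[]" _ T4 0] assms(1) by simp
  have 2: "runs (step c)
      (st ?T 0 (tr (ctr r L v) ?h) (tr (tally xs) []) T4 (int i) (support xs))
      (st ?T 0 (tr (ctr r L v1) ?h) (tr (tally xs) []) T4 (int i) (support xs)) (13 + 7 * L)"
    using step_counter[OF _ assms(2-4), of "st ?T 0 _ (tr (tally xs) []) T4 (int i) (support xs)" c v]
    by (simp add: v1_def)
  have 3: "runs (home 2)
      (st ?T 0 (tr (ctr r L v1) ?h) (tr (tally xs) []) T4 (int i) (support xs))
      (st ?T 0 (tr (ctr r L v1) []) (tr (tally xs) []) T4 (int i) (support xs)) (5 + 3 * i)"
    using home[of "st ?T 0 _ (tr (tally xs) []) T4 (int i) (support xs)" 2 "ctr r L v1" ?h] by simp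
  have 4: "runs lookup
      (st ?T 0 (tr (ctr r L v1) []) (tr (tally xs) []) T4 (int i) (support xs))
      (st ?T 0 (tr (ctr r L v1) []) (tr (tally xs) ?p) T4 (int i) (support xs))
      (18 + r * (18 + 8 * L))"
    by (rule lookup[OF assms(2)])
  have 5: "runs (bump c)
      (st ?T 0 (tr (ctr r L v1) []) (tr (tally xs) ?p) T4 (int i) (support xs))
      (st ?T 0 (tr (ctr r L v1) []) (tr (tally xs') ?p) T4 (int i) (support xs')) 5"
    unfolding xs'_def by (rule bump)
  have "length ?p = r * L"
    by (simp add: length_concat vec_def o_def del: upt_Suc)
      (simp add: sum_list_triv)
  then have 6: "runs (home 3)
      (st ?T 0 (tr (ctr r L v1) []) (tr (tally xs') ?p) T4 (int i) (support xs'))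
      (st ?T 0 (tr (ctr r L v1) []) (tr (tally xs') []) T4 (int i) (support xs')) (5 + 3 * (r * L))"
    using home[of "st ?T 0 (tr (ctr r L v1) []) _ T4 (int i) (support xs')" 3 "tally xs'" ?p] by simp
  have 7: "runs (restore c)
      (st ?T 0 (tr (ctr r L v1) []) (tr (tally xs') []) T4 (int i) (support xs'))
      (st (tr l0 h0) 0 (tr (ctr r L v1) ?h) (tr (tally xs') []) T4 0 (support xs')) (5 + 5 * i)"
    using restore[of c "l0(h0 := 0)" h0 "ctr r L v1" "[]" _ T4 i] assms(1) by (simp add: fun_upd_idem)
  have 8: "runs (step c)
      (st (tr l0 h0) 0 (tr (ctr r L v1) ?h) (tr (tally xs') []) T4 0 (support xs'))
      (st (tr l0 h0) 0 (tr (ctr r L v2) ?h) (tr (tally xs') []) T4 0 (support xs')) (13 + 7 * L)"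
    using step_counter[OF _ assms(2-4), of "st (tr l0 h0) 0 _ (tr (tally xs') []) T4 0 (support xs')" c v1]
    by (simp add: v2)
  have 9: "runs (home 2)
      (st (tr l0 h0) 0 (tr (ctr r L v2) ?h) (tr (tally xs') []) T4 0 (support xs'))
      (st (tr l0 h0) 0 (tr (ctr r L v2) []) (tr (tally xs') []) T4 0 (support xs')) (5 + 3 * i)"
    using home[of "st (tr l0 h0) 0 _ (tr (tally xs') []) T4 0 (support xs')" 2 "ctr r L v2" ?h] by simp
  have "r \<le> r * L" "L \<le> r * L" "1 \<le> r * L" "r * (18 + 8 * L) = 18 * r + 8 * (r * L)"
    using assms(2-4) by (auto simp: algebra_simps)
  \<comment> \<open>With \<open>i\<close>, \<open>r\<close>, \<open>L\<close> and 1 all at most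
    \<open>r * L\<close>, the coefficients add up to 133.\<close>
  then have bound: "5 + 5 * i + (13 + 7 * L + (5 + 3 * i + (18 + r * (18 + 8 * L) + (5 +
      (5 + 3 * (r * L) + (5 + 5 * i + (13 + 7 * L + (5 + 3 * i)))))))) \<le> 140 * (r * L)"
    using assms(4) by linarith
  show ?thesis
    unfolding process_def
    by (rule runs_Seq[OF 1 runs_Seq[OF 2 runs_Seq[OF 3 runs_Seq[OF 4 runs_Seq[OF 5
         runs_Seq[OF 6 runs_Seq[OF 7 runs_Seq[OF 8 9 order_refl] order_refl] order_refl] order_refl]
         order_refl] order_refl] order_refl] bound])
qed

fun tape :: "(bool list \<Rightarrow> int) \<Rightarrow> bool list \<Rightarrow> letter list \<Rightarrow> bool" where
  "tape l h [] \<longleftrightarrow> l h = 0"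
| "tape l h (a # w) \<longleftrightarrow> l h = letter_code a \<and> tape l (True # h) w"

lemma letter_code_sg: "letter_code a = sg (snd a) * int (fst a)"
  by (simp add: letter_code_def sg_def)

lemma words_Cons: "a # w \<in> words r \<longleftrightarrow> 1 \<le> fst a \<and> fst a \<le> r \<and> w \<in> words r"
  by (auto simp: words_def mem_Times_iff)

definition midpoint :: "(nat \<Rightarrow> int) \<times> nat \<Rightarrow> nat \<Rightarrow> int" where
  "midpoint e j = 2 * fst e j + (if j = snd e then 1 else 0)"

text \<open>Reversed because the bit read last is the lowest edge of the walk, which a vertex lists
  first.\<close>

definition address :: "nat \<Rightarrow> nat \<Rightarrow> (nat \<Rightarrow> int) \<times> nat \<Rightarrow> bool list" where
  "address r L e = rev (concat (vec r L (midpoint e)))"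

definition crossings :: "nat \<Rightarrow> nat \<Rightarrow> letter list \<Rightarrow> (nat \<Rightarrow> int) \<Rightarrow> (bool list \<times> bool) list" where
  "crossings r L w v = map (apfst (address r L)) (edges w v)"

definition process_word :: program where
  "process_word = until Is_Zero 0 (If Is_Positive 0 (process True) (process False) ;; Do Go_Right 0)"

lemma process_word:
  fixes xs :: "(bool list \<times> bool) list"
  assumes "0 < L"
  shows "w \<in> words r \<Longrightarrow> tape l h w \<Longrightarrow> runs process_word
    (st (tr l h) 0 (tr (ctr r L (\<lambda>j. 2 * v j)) []) (tr (tally xs) []) T4 0 (support xs))
    (st (tr l (replicate (length w) True @ h)) 0 (tr (ctr r L (\<lambda>j. 2 * endpoint w v j)) [])
       (tr (tally (xs @ crossings r L w v)) []) T4 0 (support (xs @ crossings r L w v)))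
    (5 + length w * (4 + 140 * (r * L)))"
proof (induction w arbitrary: h v xs)
  case Nil
  then show ?case by (simp add: process_word_def runs_until_stop crossings_def)
next
  case (Cons a w)
  obtain i c where a: "a = (i, c)" by fastforce
  have i: "1 \<le> i" "i \<le> r" and w: "w \<in> words r"
    using Cons.prems(1) by (auto simp: words_Cons a)
  have l: "l h = sg c * int i" and tape: "tape l (True # h) w"
    using Cons.prems(2) by (auto simp: letter_code_sg a)
  let ?s = "\<lambda>h0 v xs. st (tr l h0) 0 (tr (ctr r L (\<lambda>j. 2 * v j)) []) (tr (tally xs) []) T4 0 (support xs)"
  let ?xs = "xs @ [(address r L (edge v a), c)]"
  let ?s' = "?s (replicate (length (a # w)) True @ h) (endpoint (a # w) v) (xs @ crossings r L (a # w) v)"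
  \<comment> \<open>Both directions of crossing pass the same midpoint, as
    \<open>2 * v i - 1 = 2 * (v i - 1) + 1\<close>.\<close>
  have mid: "(\<lambda>j. 2 * v j)(i := 2 * v i + sg c) = midpoint (edge v a)"
    by (rule ext) (auto simp: midpoint_def edge_def a fun_upd_apply sg_def)
  have "(\<lambda>j. 2 * v j)(i := 2 * v i + 2 * sg c) = (\<lambda>j. 2 * move v a j)"
    by (rule ext) (auto simp: move_def a fun_upd_apply)
  then have 1: "runs (process c) (?s h v xs) (?s h (move v a) ?xs) (140 * (r * L))"
    using process[of l h c i L r "\<lambda>j. 2 * v j" xs T4] l assms(1) i by (simp add: mid address_def)
  have "xs @ crossings r L (a # w) v = ?xs @ crossings r L w (move v a)"
    by (simp add: crossings_def a)
  then have 2: "runs (Do Go_Right 0 ;; process_word) (?s h (move v a) ?xs) ?s'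
      (6 + length w * (4 + 140 * (r * L)))"
    using Cons.IH[OF w tape, of "move v a" ?xs] by (simp add: replicate_app_Cons_same)
  have "runs (process c ;; Do Go_Right 0 ;; process_word) (?s h v xs) ?s'
      (6 + 140 * (r * L) + length w * (4 + 140 * (r * L)))"
    by (rule runs_Seq[OF 1 2]) simp
  moreover have "l h \<noteq> 0" "0 < l h \<longleftrightarrow> c"
    using i(1) l by (auto simp: sg_def)
  ultimately have "runs process_word (?s h v xs) ?s'
      (9 + 140 * (r * L) + length w * (4 + 140 * (r * L)))"
    unfolding process_word_def by (subst runs_until_step) (auto simp: add.assoc)
  then show ?case
    by (simp add: algebra_simps)
qed

section \<open>Initialisation\<close>

text \<open>The number of bits is found by counting the letters of the word in bijective binary
  notation, with digits 1 and 2 represented by \<open>False\<close> and \<open>True\<close>.\<close>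

fun bijective_value :: "bool list \<Rightarrow> nat" where
  "bijective_value [] = 0"
| "bijective_value (d # ds) = (if d then 2 else 1) + 2 * bijective_value ds"

abbreviation succ :: "bool list \<Rightarrow> bool list" where
  "succ \<equiv> carry True [False]"

lemma bijective_value_succ: "bijective_value (succ ds) = Suc (bijective_value ds)"
  by (induction ds) auto

lemma length_succ: "length ds \<le> length (succ ds)"
  by (induction ds) auto

lemma length_succ_funpow: "length ds \<le> length ((succ ^^ n) ds)"
  by (induction n) (auto intro: order_trans[OF _ length_succ])

text \<open>Equality holds when all digits are 1, and in the next bound when all digits are 2.
  Together they make the length logarithmic in the value from both sides.\<close>

lemma bijective_value_lower: "2 ^ length ds \<le> bijective_value ds + 1"
  by (induction ds) auto

lemma bijective_value_upper: "bijective_value ds + 2 \<le> 2 ^ (length ds + 1)"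
  by (induction ds) auto

definition bijective :: "nat \<Rightarrow> bool list" where
  "bijective n = (succ ^^ n) []"

lemma bijective_value_bijective: "bijective_value (bijective n) = n"
  by (induction n) (auto simp: bijective_def bijective_value_succ)

definition template :: "bool list \<Rightarrow> bool list \<Rightarrow> int" where
  "template = put (\<lambda>_. 0) [False]"

definition grow :: program where
  "grow = Do Go_Left 4 ;; increment 4 (Do Dec 4) ;; home 4"

lemma grow:
  "runs grow (st T0 0 T2 T3 (tr (template ds) []) x n)
     (st T0 0 T2 T3 (tr (template (succ ds)) []) x n) (13 + 7 * length ds)"
proof -
  let ?s = "\<lambda>T. st T0 0 T2 T3 T x n"
  have "line (template ds) [False] ds"
    unfolding template_def by (rule line_put) simp
  moreover have "put (template ds) [False] (succ ds) = template (succ ds)"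
    unfolding template_def by (rule put_put) (rule length_succ)
  ultimately obtain m where m: "m \<le> length ds"
    "runs (increment 4 (Do Dec 4)) (?s (tr (template ds) [False]))
      (?s (tr (template (succ ds)) (replicate m False @ [False]))) (4 + 4 * length ds)"
    using increment[of "template ds" "[False]" ds "Do Dec 4" "?s undefined" 4 "[False]"] by auto
  have "runs (home 4) (?s (tr (template (succ ds)) (replicate m False @ [False])))
      (?s (tr (template (succ ds)) [])) (8 + 3 * m)"
    using home[of "?s undefined" 4 "template (succ ds)" "replicate m False @ [False]"] by simp
  then have "runs (increment 4 (Do Dec 4) ;; home 4) (?s (tr (template ds) [False]))
      (?s (tr (template (succ ds)) [])) (12 + 7 * length ds)"
    using m(1) by (intro runs_Seq[OF m(2)]) auto
  then show ?thesis
    by (simp add: grow_def)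
qed

definition count_letters :: program where
  "count_letters = until Is_Zero 0 (grow ;; Do Go_Right 0)"

text \<open>The numeral never gets shorter, so a bound \<open>m\<close> on its final length bounds
  the cost of every \<open>grow\<close>. The carries need no amortised analysis.\<close>

lemma count_letters:
  "w \<in> words r \<Longrightarrow> tape l h w \<Longrightarrow> length ((succ ^^ length w) ds) \<le> m \<Longrightarrow>
   runs count_letters (st (tr l h) 0 T2 T3 (tr (template ds) []) x n)
     (st (tr l (replicate (length w) True @ h)) 0 T2 T3 (tr (template ((succ ^^ length w) ds)) []) x n)
     (5 + length w * (16 + 7 * m))"
proof (induction w arbitrary: h ds)
  case Nil
  then show ?case by (simp add: count_letters_def runs_until_stop)
next
  case (Cons a w)
  let ?s = "\<lambda>h ds. st (tr l h) 0 T2 T3 (tr (template ds) []) x n"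
  let ?s' = "?s (replicate (length (a # w)) True @ h) ((succ ^^ length (a # w)) ds)"
  have "l h \<noteq> 0"
    using Cons.prems(1,2) by (auto simp: words_Cons letter_code_sg)
  have *: "(succ ^^ length (a # w)) ds = (succ ^^ length w) (succ ds)"
    by (simp add: funpow_swap1)
  have "length ds \<le> m"
    using Cons.prems(3) length_succ_funpow[of ds "length (a # w)"] by linarith
  have "runs count_letters (?s (True # h) (succ ds)) ?s' (5 + length w * (16 + 7 * m))"
    using Cons.IH[of "True # h" "succ ds"] Cons.prems
    by (simp only: * words_Cons) (simp add: replicate_app_Cons_same)
  then have 1: "runs (Do Go_Right 0 ;; count_letters) (?s h (succ ds)) ?s' (6 + length w * (16 + 7 * m))"
    by simp
  have "runs (grow ;; Do Go_Right 0 ;; count_letters) (?s h ds) ?s' (19 + 7 * m + length w * (16 + 7 * m))"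
    using \<open>length ds \<le> m\<close> by (intro runs_Seq[OF grow 1]) simp
  then show ?case
    using \<open>l h \<noteq> 0\<close> unfolding count_letters_def by (subst runs_until_step) (simp_all add: add.assoc)
qed

definition copy :: program where
  "copy = until Is_Zero 4 (Do Dec 2 ;; Do Go_Left 2 ;; Do Go_Left 4)"

lemma copy:
  "line l4 h4 ds \<Longrightarrow> (\<And>m. l2 (replicate m False @ h2) = 0) \<Longrightarrow>
   runs copy (st T0 0 (tr l2 h2) T3 (tr l4 h4) x n)
     (st T0 0 (tr (put l2 h2 (replicate (length ds) False)) (replicate (length ds) False @ h2)) T3
        (tr l4 (replicate (length ds) False @ h4)) x n) (5 + 5 * length ds)"
  unfolding copy_def
proof (induction ds arbitrary: l2 h2 h4)
  case Nil
  then show ?case by (simp add: runs_until_stop)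
next
  case (Cons d ds)
  have "(l2(h2 := - 1)) (replicate m False @ False # h2) = 0" for m
    using Cons.prems(2)[of "Suc m"] by (simp add: replicate_app_Cons_same fun_upd_apply)
  moreover have "l2 h2 = 0"
    using Cons.prems(2)[of 0] by simp
  ultimately show ?case
    using Cons.IH[of "False # h4" "l2(h2 := - 1)" "False # h2"] Cons.prems(1)
    by (simp add: runs_until_step replicate_app_Cons_same)
qed

text \<open>Three more bits than the counted length make the modulus exceed four times the length
  of the word, so that the vertices of its path remain distinct.\<close>

definition fill :: program where
  "fill = Do Go_Right 2 ;; Do Go_Left 2 ;; Do Dec 2 ;; Do Go_Left 2 ;; Do Dec 2 ;; Do Go_Left 2 ;;
     Do Dec 2 ;; Do Go_Left 2 ;; Do Go_Left 4 ;; copy ;; climb 2 ;; home 4"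

lemma fill:
  assumes "\<And>u. l2 (u @ True # h) = 0"
  shows "runs fill (st T0 0 (tr l2 h) T3 (tr (template ds) []) x n)
    (st T0 0 (tr (put l2 (False # True # h) (replicate (length ds + 3) False)) (True # h)) T3
       (tr (template ds) []) x n) (37 + 11 * length ds)"
proof -
  let ?h = "False # True # h" and ?n = "length ds"
  let ?s = "\<lambda>l2 h2 h4. st T0 0 (tr l2 h2) T3 (tr (template ds) h4) x n"
  let ?l = "l2(?h := - 1, False # ?h := - 1, False # False # ?h := - 1)"
  define l' where "l' = put l2 ?h (replicate (?n + 3) False)"
  have l'_eq: "put ?l (False # False # False # ?h) (replicate ?n False) = l'"
    by (simp add: l'_def numeral_3_eq_3)
  have zero: "l2 (replicate m False @ ?h) = 0" "l2 (True # h) = 0" for m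
    using assms[of "replicate m False @ [False]"] assms[of "[]"] by simp_all
  have "line (template ds) [False] ds"
    unfolding template_def by (rule line_put) simp
  moreover have "?l (replicate m False @ False # False # False # ?h) = 0" for m
    using zero(1)[of "m + 3"] by (simp add: fun_upd_apply numeral_3_eq_3 replicate_app_Cons_same)
  ultimately have 1: "runs copy (?s ?l (False # False # False # ?h) [False])
      (?s l' (replicate (?n + 3) False @ ?h) (replicate ?n False @ [False])) (5 + 5 * ?n)"
    using copy[of "template ds" "[False]" ds ?l "False # False # False # ?h" T0 T3 x n]
    by (simp add: l'_eq numeral_3_eq_3 replicate_app_Cons_same)
  have "line l' ?h (replicate (?n + 3) False)"
    unfolding l'_def by (rule line_put) (simp only: length_replicate zero(1))
  moreover have "l' (True # h) = 0"
    using zero(2) by (auto simp: l'_def put_apply)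
  ultimately have 2: "runs (climb 2)
      (?s l' (replicate (?n + 3) False @ ?h) (replicate ?n False @ [False]))
      (?s l' (True # h) (replicate ?n False @ [False])) (15 + 3 * ?n)"
    using climb[of "?s undefined undefined (replicate ?n False @ [False])" 2 l' "True # h"
        "replicate (?n + 3) False" "?n + 3"] by simp
  have 3: "runs (home 4) (?s l' (True # h) (replicate ?n False @ [False])) (?s l' (True # h) [])
      (8 + 3 * ?n)"
    using home[of "?s l' (True # h) undefined" 4 "template ds" "replicate ?n False @ [False]"] by simp
  have "runs (copy ;; climb 2 ;; home 4) (?s ?l (False # False # False # ?h) [False])
      (?s l' (True # h) []) (28 + 11 * ?n)"
    by (rule runs_Seq[OF 1 runs_Seq[OF 2 3 order_refl]]) simp
  then show ?thesis
    using assms[of "[False]"] assms[of "[False, False]"] assms[of "[False, False, False]"]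
    by (simp add: fill_def flip: l'_def)
qed

text \<open>This consumes the rank at the root of tree 0; the word lies below the root and stays
  intact.\<close>

definition allocate :: program where
  "allocate = until Is_Zero 0 (Do Dec 0 ;; fill)"

lemma allocate:
  "l0 h0 = int k \<Longrightarrow> (\<And>u. l2 (u @ True # h) = 0) \<Longrightarrow>
   runs allocate (st (tr l0 h0) 0 (tr l2 h) T3 (tr (template ds) []) x n)
     (st (tr (l0(h0 := 0)) h0) 0
        (tr (puts l2 (True # h) (replicate k (replicate (length ds + 3) False))) (replicate k True @ h))
        T3 (tr (template ds) []) x n)
     (5 + k * (40 + 11 * length ds))"
proof (induction k arbitrary: l0 l2 h)
  case 0
  then show ?case by (simp add: allocate_def runs_until_stop fun_upd_idem)
next
  case (Suc k)
  let ?L = "length ds + 3"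
  let ?l = "put l2 (False # True # h) (replicate ?L False)"
  let ?s = "\<lambda>l0 l2 h. st (tr l0 h0) 0 (tr l2 h) T3 (tr (template ds) []) x n"
  let ?a = "l0(h0 := int k)"
  let ?s' = "?s (l0(h0 := 0)) (puts l2 (True # h) (replicate (Suc k) (replicate ?L False)))
    (replicate (Suc k) True @ h)"
  have ne: "replicate m False @ False # True # h \<noteq> u @ True # True # h" for m u
  proof
    assume "replicate m False @ False # True # h = u @ True # True # h"
    then have "(replicate m False @ [False]) @ True # h = (u @ [True]) @ True # h" by simp
    then have "replicate m False @ [False] = u @ [True]" by (simp only: append_same_eq)
    then show False by simp
  qed
  have "?l (u @ True # True # h) = 0" for u
    using Suc.prems(2)[of "u @ [True]"] by (simp add: put_apply ne[symmetric])
  then have 1: "runs allocate (?s ?a ?l (True # h)) ?s' (5 + k * (40 + 11 * length ds))"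
    using Suc.IH[of ?a ?l "True # h"] by (simp add: replicate_app_Cons_same)
  have 2: "runs fill (?s ?a l2 h) (?s ?a ?l (True # h)) (37 + 11 * length ds)"
    using Suc.prems(2) by (rule fill)
  have "runs (fill ;; allocate) (?s ?a l2 h) ?s' (42 + 11 * length ds + k * (40 + 11 * length ds))"
    by (rule runs_Seq[OF 2 1]) simp
  then show ?case
    using Suc.prems(1) unfolding allocate_def
    by (subst runs_until_step) (simp_all add: add.assoc)
qed

section \<open>The algorithm\<close>

lemma tape_input_label:
  "k \<le> length w \<Longrightarrow> tape (input_label r w) (replicate (Suc k) True) (drop k w)"
proof (induction "length w - k" arbitrary: k)
  case 0
  then show ?case by (simp add: input_label_def)
next
  case (Suc n)
  then have "k < length w" by simp
  moreover have "tape (input_label r w) (replicate (Suc (Suc k)) True) (drop (Suc k) w)"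
    using Suc.hyps by (intro Suc.hyps(1)) auto
  ultimately show ?case
    by (simp add: input_label_def Cons_nth_drop_Suc[symmetric])
qed

lemma tape_update_root: "tape (l([] := x)) (b # h) w = tape l (b # h) w"
  by (induction w arbitrary: b h) auto

lemma st_input_state:
  "input_state r w = st (tr (input_label r w) []) 0 (tr (\<lambda>_. 0) []) (tr (\<lambda>_. 0) [])
     (tr (template []) []) 0 0"
proof -
  have "cell 0 = tr (\<lambda>_. 0) []"
    by (simp add: cell_def fun_upd_idem)
  then show ?thesis
    by (intro ext) (simp add: input_state_def st_def template_def)
qed

definition decide :: program where
  "decide = Do Go_Right 0 ;; count_letters ;; home 0 ;; allocate ;; home 2 ;; Do Go_Right 0 ;; process_word ;;
     If Is_Zero 6 (Do Inc 1) Skip"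

definition width :: "nat \<Rightarrow> nat" where
  "width n = length (bijective n) + 3"

lemma decide_runs:
  assumes w: "w \<in> words r"
  defines "n \<equiv> length w" and "L \<equiv> width (length w)"
  shows "\<exists>s. runs decide (input_state r w) s
      (32 + 23 * n + 7 * (n * L) + 43 * r + 11 * (r * L) + 140 * (n * (r * L)))
    \<and> answer s = (if \<forall>k. tally (crossings r L w origin) k = 0 then 1 else 0)"
proof -
  let ?l = "input_label r w" and ?ds = "bijective n" and ?xs = "crossings r L w origin"
  let ?l2 = "?l([] := 0)"
  let ?z = "tr (\<lambda>_. 0) []" and ?t = "tr (template (bijective n)) []"
  have L: "length ?ds + 3 = L" "0 < L"
    by (simp_all add: L_def width_def n_def)
  have tape: "tape ?l [True] w"
    using tape_input_label[of 0 w r] by simp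
  have 1: "runs count_letters (st (tr ?l [True]) 0 ?z ?z (tr (template []) []) 0 0)
      (st (tr ?l (replicate n True @ [True])) 0 ?z ?z ?t 0 0) (5 + n * (16 + 7 * L))"
    using count_letters[OF w tape, of "[]" L] L(1) by (simp add: n_def bijective_def)
  have 2: "runs (home 0) (st (tr ?l (replicate n True @ [True])) 0 ?z ?z ?t 0 0)
      (st (tr ?l []) 0 ?z ?z ?t 0 0) (8 + 3 * n)"
    using home[of "st undefined 0 ?z ?z ?t 0 0" 0 ?l "replicate n True @ [True]"] by simp
  \<comment> \<open>The freshly allocated comb, with all bits \<open>False\<close>, stands for the
    origin.\<close>
  have "puts (\<lambda>_. 0) [True] (replicate r (replicate L False)) = ctr r L (\<lambda>j. 2 * origin j)"
    by (simp add: ctr_def vec_def bits_0 map_replicate_const del: upt_Suc)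
  then have 3: "runs allocate (st (tr ?l []) 0 ?z ?z ?t 0 0)
      (st (tr ?l2 []) 0 (tr (ctr r L (\<lambda>j. 2 * origin j)) (replicate r True)) ?z ?t 0 0)
      (5 + r * (40 + 11 * L))"
    using allocate[of ?l "[]" r "\<lambda>_. 0" "[]" ?z ?ds 0 0] L(1)
    by (auto simp: input_label_def elim: runs_mono)
  have 4: "runs (home 2) (st (tr ?l2 []) 0 (tr (ctr r L (\<lambda>j. 2 * origin j)) (replicate r True)) ?z ?t 0 0)
      (st (tr ?l2 []) 0 (tr (ctr r L (\<lambda>j. 2 * origin j)) []) ?z ?t 0 0) (5 + 3 * r)"
    using home[of "st (tr ?l2 []) 0 undefined ?z ?t 0 0" 2 "ctr r L (\<lambda>j. 2 * origin j)"
        "replicate r True"] by simp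
  let ?s = "st (tr ?l2 (replicate n True @ [True])) 0 (tr (ctr r L (\<lambda>j. 2 * endpoint w origin j)) [])
    (tr (tally ?xs) []) ?t 0 (support ?xs)"
  let ?s' = "if support ?xs = 0 then ?s(1 := cell 1) else ?s"
  have 0: "tally [] = (\<lambda>_. 0)" "support ([] :: (bool list \<times> bool) list) = 0"
    by (auto simp: support_def)
  have 5: "runs process_word (st (tr ?l2 [True]) 0 (tr (ctr r L (\<lambda>j. 2 * origin j)) []) ?z ?t 0 0) ?s
      (5 + n * (4 + 140 * (r * L)))"
    using process_word[OF L(2) w, of ?l2 "[True]" origin "[]" ?t] tape
    by (simp add: 0 tape_update_root n_def)
  have 6: "runs (If Is_Zero 6 (Do Inc 1) Skip) ?s ?s' 2"
    by simp
  have 7: "runs (Do Go_Right 0 ;; process_word ;; If Is_Zero 6 (Do Inc 1) Skip)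
      (st (tr ?l2 []) 0 (tr (ctr r L (\<lambda>j. 2 * origin j)) []) ?z ?t 0 0) ?s'
      (8 + n * (4 + 140 * (r * L)))"
    using runs_Seq[OF 5 6 order_refl] by simp
  have "runs decide (input_state r w) ?s' (1 + (5 + n * (16 + 7 * L) + (8 + 3 * n +
      (5 + r * (40 + 11 * L) + (5 + 3 * r + (8 + n * (4 + 140 * (r * L))))))))"
    using runs_Seq[OF 1 runs_Seq[OF 2 runs_Seq[OF 3 runs_Seq[OF 4 7 order_refl] order_refl] order_refl]
      order_refl]
    by (simp add: decide_def st_input_state)
  then have "runs decide (input_state r w) ?s'
      (32 + 23 * n + 7 * (n * L) + 43 * r + 11 * (r * L) + 140 * (n * (r * L)))"
    by (rule runs_mono) (simp add: algebra_simps)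
  moreover have "answer ?s' = (if \<forall>k. tally ?xs k = 0 then 1 else 0)"
    using support_eq_0_iff[of ?xs] by (auto simp: answer_def cell_def)
  ultimately show ?thesis by blast
qed

section \<open>Size of the counters and injectivity of the addresses\<close>

lemma width_lower: "4 * n + 8 \<le> 2 ^ width n"
  \<comment> \<open>Four times the bound on \<open>n + 2\<close>, as
    \<open>2 ^ (length + 3) = 4 * 2 ^ (length + 1)\<close>.\<close>
  using bijective_value_upper[of "bijective n"] by (simp add: width_def bijective_value_bijective power_add)

text \<open>The factor is 2 + 3: since \<open>n + 1 \<le> n ^ 2\<close>, the numeral has at most
  \<open>2 * log 2 n\<close> digits, and the three extra bits are absorbed by
  \<open>1 \<le> log 2 n\<close>.\<close>

lemma width_upper:
  assumes "2 \<le> n"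
  shows "real (width n) \<le> 5 * log 2 (real n)"
proof -
  have log: "1 \<le> log 2 (real n)"
    using assms by simp
  have "2 ^ length (bijective n) \<le> n + 1"
    using bijective_value_lower[of "bijective n"] by (simp add: bijective_value_bijective)
  also have "n + 1 \<le> n ^ 2"
    using assms by (cases n) (auto simp: power2_eq_square)
  finally have "2 ^ length (bijective n) \<le> n ^ 2" .
  then have "real (2 ^ length (bijective n)) \<le> real (n ^ 2)"
    by (rule of_nat_mono)
  then have "log 2 (2 ^ length (bijective n)) \<le> log 2 (real n ^ 2)"
    using assms by (subst log_le_cancel_iff) auto
  then have "real (length (bijective n)) \<le> 2 * log 2 (real n)"
    using assms by (simp add: log_nat_power)
  with log show ?thesis
    by (simp add: width_def)
qed

text \<open>An address shows only the coordinates in \<open>{1..r}\<close>, and these only modulo a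
  power of two. The bounds and the fixed remaining coordinates supply what is missing to recover the
  edge.\<close>

lemma edges_near:
  "w \<in> words r \<Longrightarrow> x \<in> set (edges w v) \<Longrightarrow>
    1 \<le> snd (fst x) \<and> snd (fst x) \<le> r \<and> (\<forall>j. \<bar>fst (fst x) j - v j\<bar> \<le> int (length w)) \<and>
    (\<forall>j. j \<notin> {1..r} \<longrightarrow> fst (fst x) j = v j)"
proof (induction w arbitrary: v)
  case (Cons a w)
  then have a: "1 \<le> fst a" "fst a \<le> r" and w: "w \<in> words r"
    by (auto simp: words_Cons)
  have mv: "\<bar>move v a j - v j\<bar> \<le> 1" "j \<notin> {1..r} \<Longrightarrow> move v a j = v j" for j
    using a by (auto simp: move_def fun_upd_apply sg_def)
  consider "x = (edge v a, snd a)" | "x \<in> set (edges w (move v a))"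
    using Cons.prems(2) by auto
  then show ?case
  proof cases
    case 1
    with a show ?thesis by (auto simp: edge_def fun_upd_apply)
  next
    case 2
    note IH = Cons.IH[OF w 2]
    have "\<bar>fst (fst x) j - v j\<bar> \<le> int (length (a # w))" for j
    proof -
      have "\<bar>fst (fst x) j - move v a j\<bar> \<le> int (length w)"
        using IH by blast
      with mv(1)[of j] show ?thesis by simp
    qed
    with IH mv(2) show ?thesis by auto
  qed
qed simp

text \<open>The unique odd coordinate gives the direction; the initial vertex is then obtained by
  halving.\<close>

lemma midpoint_inj:
  assumes "\<And>j. midpoint e j = midpoint e' j"
  shows "e = e'"
proof -
  have odd: "odd (midpoint e j) \<longleftrightarrow> j = snd e" for e j
    by (simp add: midpoint_def)
  have "snd e = snd e'"
    using odd[of e "snd e"] odd[of e' "snd e"] assms by simp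
  moreover from this have "fst e j = fst e' j" for j
    using assms[of j] by (simp add: midpoint_def)
  ultimately show ?thesis
    by (simp add: prod_eq_iff fun_eq_iff)
qed

lemma inj_on_address:
  assumes "w \<in> words r"
  shows "inj_on (address r (width (length w))) (fst ` set (edges w origin))"
proof (rule inj_onI)
  let ?L = "width (length w)"
  fix e e' assume e: "e \<in> fst ` set (edges w origin)" and e': "e' \<in> fst ` set (edges w origin)"
    and eq: "address r ?L e = address r ?L e'"
  have near: "1 \<le> snd d \<and> snd d \<le> r \<and> (\<forall>j. \<bar>fst d j\<bar> \<le> int (length w)) \<and>
      (\<forall>j. j \<notin> {1..r} \<longrightarrow> fst d j = 0)" if "d \<in> fst ` set (edges w origin)" for d
    using edges_near[OF assms, of _ origin] that by fastforce
  have vec: "vec r ?L (midpoint e) = vec r ?L (midpoint e')"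
  proof (rule concat_injective)
    show "concat (vec r ?L (midpoint e)) = concat (vec r ?L (midpoint e'))"
      using eq by (simp add: address_def)
    show "\<forall>(x, y) \<in> set (zip (vec r ?L (midpoint e)) (vec r ?L (midpoint e'))). length x = length y"
      by (auto simp: vec_def zip_map_map zip_same_conv_map simp del: upt_Suc)
  qed simp
  have "midpoint e j = midpoint e' j" for j
  proof (cases "j \<in> {1..r}")
    case True
    then obtain i where i: "j = Suc i" "i < r" by (cases j) auto
    \<comment> \<open>Doubled coordinates differ by at most four times the length, and the half step
      of a single edge adds at most 1.\<close>
    have "\<bar>midpoint e j - midpoint e' j\<bar> \<le> 4 * int (length w) + 1"
      using near[OF e] near[OF e'] unfolding midpoint_def
      by (smt (verit))
    also have "\<dots> < 2 ^ ?L"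
      using of_nat_mono[OF width_lower[of "length w"], where ?'a = int] by simp
    finally show ?thesis
      using arg_cong[OF vec, of "\<lambda>ds. ds ! i"] i by (auto simp: vec_nth intro: bits_inj)
  next
    case False
    with near[OF e] near[OF e'] show ?thesis by (auto simp: midpoint_def)
  qed
  then show "e = e'"
    by (rule midpoint_inj)
qed

theorem theorem3p5:
  shows "\<exists>(P :: program) (C :: real). \<forall>(r :: nat). \<forall>w \<in> words r. \<exists>(t :: nat) (s :: state).
           exec P (input_state r w) t s
         \<and> answer s = (if represented r w = \<one>\<^bsub>free_metabelian r\<^esub> then 1 else 0)
         \<and> (length w \<ge> 2 \<longrightarrow>
              real t \<le> C * (real r * real (length w) * log 2 (real (length w))))"
proof (rule exI[of _ decide], rule exI[of _ 1280], intro allI ballI)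
  fix r w assume w: "w \<in> words r"
  let ?n = "length w" and ?L = "width (length w)"
  obtain s where "runs decide (input_state r w) s
      (32 + 23 * ?n + 7 * (?n * ?L) + 43 * r + 11 * (r * ?L) + 140 * (?n * (r * ?L)))"
    and s: "answer s = (if \<forall>k. tally (crossings r ?L w origin) k = 0 then 1 else 0)"
    using decide_runs[OF w] by blast
  then obtain t where t: "exec decide (input_state r w) t s"
    "t \<le> 32 + 23 * ?n + 7 * (?n * ?L) + 43 * r + 11 * (r * ?L) + 140 * (?n * (r * ?L))"
    by (auto simp: runs_def)
  have "answer s = (if represented r w = \<one>\<^bsub>free_metabelian r\<^esub> then 1 else 0)"
    using s tally_map_eq_0_iff[OF inj_on_address[OF w]] represented_eq_one_iff[OF w]
    by (simp add: crossings_def)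
  moreover have "real t \<le> 1280 * (real r * real ?n * log 2 (real ?n))" if n: "2 \<le> ?n"
  proof -
    \<comment> \<open>A nonempty word contains a generator; with \<open>r = 0\<close> the claimed
      bound would be 0.\<close>
    have "1 \<le> r"
      using w n by (cases w) (auto simp: words_Cons)
    define q where "q = ?n * (r * ?L)"
    have "1 \<le> ?L" "1 \<le> ?n"
      using n by (auto simp: width_def)
    then have "1 \<le> q" "?n \<le> q" "?n * ?L \<le> q" "r \<le> q" "r * ?L \<le> q"
      using \<open>1 \<le> r\<close> by (auto simp: q_def)
    \<comment> \<open>The coefficients 32, 23, 7, 43, 11 and 140 add up to 256; the factor 5 of
      \<open>width_upper\<close> then gives 1280.\<close>
    then have "t \<le> 256 * q"
      using t(2) unfolding q_def[symmetric] by linarith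
    then have "real t \<le> 256 * real q"
      by linarith
    also have "real q = real r * real ?n * real ?L"
      by (simp add: q_def)
    also have "\<dots> \<le> real r * real ?n * (5 * log 2 (real ?n))"
      by (intro mult_left_mono width_upper n) simp
    finally show ?thesis by simp
  qed
  ultimately show "\<exists>t s. exec decide (input_state r w) t s
      \<and> answer s = (if represented r w = \<one>\<^bsub>free_metabelian r\<^esub> then 1 else 0)
      \<and> (length w \<ge> 2 \<longrightarrow> real t \<le> 1280 * (real r * real (length w) * log 2 (real (length w))))"
    using t(1) by blast
qed

end
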